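(* Let $r\ge 2$ and $1\le i\le r$ be integers. For all integers $m,n$ we have \[ b_{r,i}(m,n)=c_{r,i}(m,n). \]
   Context: A partition of $n$ is a non-increasing finite sequence of positive integers with sum $n$; the empty partition is the only partition of $0$. For integers $r\ge2$, $1\le i\le r$, $\mathcal{B}_{r,i}(n)$ is the set of partitions $(\lambda_1\ge\dots\ge\lambda_s)$ of $n$ such that $\lambda_j-\lambda_{j+r-1}\ge2$ for all $1\le j\le s-r+1$ and at most $i-1$ of the parts are equal to $1$. $b_{r,i}(m,n)$ is the number of partitions in $\mathcal{B}_{r,i}(n)$ with exactly $m$ parts. Successive Durfee rectangles/squares: the Durfee square of a partition is the largest square ($d$ rows, $d$ columns, $d\ge 0$) that fits in the top-left corner of its Young diagram; the horizontal Durfee rectangle is the largest rectangle with $d$ rows and $d+1$ columns, $d\ge0$, that fits in the top-left corner of its Young diagram (the case $d=0$ occupies no rows and is allowed). Successive Durfee squares/rectangles are obtained by taking the first one, then the one of the partition consisting of the rows strictly below it, and so on. $\mathcal{C}_{r,i}(n)$ is the set of partitions of $n$ such that, after taking first $r-i$ successive horizontal Durfee rectangles and then $i-1$ successive Durfee squares (any of these possibly with $d=0$), no parts (rows) of the partition remain below. $c_{r,i}(m,n)$ is the number of partitions in $\mathcal{C}_{r,i}(n)$ with exactly $m$ parts. *)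

theory Defs imports Main begin

text \<open>
  A partition is the list of its parts in non-increasing order. The size \<open>n\<close> and the number of
  parts \<open>m\<close> range over all integers, so that there are no partitions if one of them is negative.
\<close>

definition partitions :: "int \<Rightarrow> nat list set" where
  "partitions n = {p. sorted_wrt (\<ge>) p \<and> (\<forall>x\<in>set p. 0 < x) \<and> int (sum_list p) = n}"

lemma finite_partitions: "finite (partitions n)"
proof (rule finite_subset)
  show "partitions n \<subseteq> {p. set p \<subseteq> {..nat n} \<and> length p \<le> nat n}"
  proof
    fix p assume p: "p \<in> partitions n"
    have "length q \<le> sum_list q" if "\<forall>x\<in>set q. 0 < x" for q :: "nat list"
      using that by (induction q) auto
    then show "p \<in> {p. set p \<subseteq> {..nat n} \<and> length p \<le> nat n}"
      using p member_le_sum_list[of _ p] by (fastforce simp: partitions_def)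
  qed
  show "finite {p. set p \<subseteq> {..nat n} \<and> length p \<le> nat n}"
    by (rule finite_lists_length_le) simp
qed

text \<open>List positions start at 0, so the \<open>j\<close> below is one less than the usual index of a part.\<close>

definition \<B> :: "nat \<Rightarrow> nat \<Rightarrow> int \<Rightarrow> nat list set" where
  "\<B> r i n = {p \<in> partitions n.
     (\<forall>j. j + r - 1 < length p \<longrightarrow> p ! j \<ge> p ! (j + r - 1) + 2) \<and> count_list p 1 \<le> i - 1}"

definition b_parts :: "nat \<Rightarrow> nat \<Rightarrow> int \<Rightarrow> int \<Rightarrow> nat" where
  "b_parts r i m n = card {p \<in> \<B> r i n. int (length p) = m}"

definition young_diagram :: "nat list \<Rightarrow> (nat \<times> nat) set" where
  "young_diagram p = {(row, col). row < length p \<and> col < p ! row}"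

text \<open>
  The number \<open>d\<close> of rows of the largest rectangle with \<open>d\<close> rows and \<open>d + e\<close> columns in the top-left
  corner: the Durfee square for \<open>e = 0\<close>, the horizontal Durfee rectangle for \<open>e = 1\<close>.
\<close>

definition durfee_rows :: "nat \<Rightarrow> nat list \<Rightarrow> nat" where
  "durfee_rows e p = Max {d. {..<d} \<times> {..<d + e} \<subseteq> young_diagram p}"

lemma finite_durfee: "finite {d. {..<d} \<times> {..<d + e} \<subseteq> young_diagram p}"
proof (rule finite_subset)
  show "{d. {..<d} \<times> {..<d + e} \<subseteq> young_diagram p} \<subseteq> {..length p}"
  proof
    fix d assume d: "d \<in> {d. {..<d} \<times> {..<d + e} \<subseteq> young_diagram p}"
    show "d \<in> {..length p}"
    proof (cases d)
      case (Suc k)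
      then have "(k, 0) \<in> young_diagram p" using d by auto
      then show ?thesis using Suc by (simp add: young_diagram_def)
    qed simp
  qed
qed simp

definition below_durfee :: "nat \<Rightarrow> nat list \<Rightarrow> nat list" where
  "below_durfee e p = drop (durfee_rows e p) p"

definition \<C> :: "nat \<Rightarrow> nat \<Rightarrow> int \<Rightarrow> nat list set" where
  "\<C> r i n = {p \<in> partitions n.
     (below_durfee 0 ^^ (i - 1)) ((below_durfee 1 ^^ (r - i)) p) = []}"

definition c_parts :: "nat \<Rightarrow> nat \<Rightarrow> int \<Rightarrow> int \<Rightarrow> nat" where
  "c_parts r i m n = card {p \<in> \<C> r i n. int (length p) = m}"

end

theory Submission
  imports Defs "HOL-Computational_Algebra.Formal_Laurent_Series"
begin

text \<open>
Write \<open>F i x\<close> for the sum of \<open>x ^ length p * q ^ sum_list p\<close> over one of the two families of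
  partitions with parameters \<open>r\<close> and \<open>i\<close>. For both families
  \<open>F i x = F (i - 1) x + (x * q) ^ (i - 1) * F (r - i + 1) (x * q)\<close>, with \<open>F 0\<close> read as 0. In terms of the
  numbers of partitions of \<open>n\<close> with \<open>m\<close> parts this is a recurrence which, for \<open>m > 0\<close>, goes back to
  smaller \<open>n\<close> or to the same \<open>n\<close> and smaller \<open>i\<close>; since the counts with \<open>m = 0\<close> agree, it determines
  them.

  For the partitions with a gap condition the recurrence is visible: those with exactly \<open>i - 1\<close> ones
  lose their ones and have the other parts decreased by 1. The gap condition between the ones and
  the parts above them becomes a bound on the number of new ones (\<open>b_parts_recurrence\<close>).

  For the Durfee dissections no such decomposition is visible, and the functional equation comes
  from the Bailey lattice. Let the largest part be at most \<open>N\<close>. A partition whose Durfee square has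
  side \<open>d\<close> consists of the square, a partition to its right that fits into a \<open>d\<close> by \<open>N - d\<close> box, and a
  partition below it with parts at most \<open>d\<close>. So adding one more square on top turns the generating
  function \<open>f d\<close> of what is below into
  \<open>T x f N = (\<Sum>d\<le>N. x ^ d * q ^ (d * d) * [N choose d] * f d)\<close> with a Gaussian binomial coefficient;
  a rectangle with one more column gives the operator \<open>T (x * q)\<close>, with the arguments of \<open>f\<close> and of
  the result moved by one. The Bailey lemma says that \<open>T x\<close> has eigenvectors in closed form
  (\<open>durfee_op_bailey_kernel\<close>), and the constant 1, with which the dissection ends at the bottom, is
  \<open>T x\<close> applied to the unit at 0, whose expansion in eigenvectors is known (\<open>bailey_alpha_unit\<close>).
  At the change from squares to rectangles, a moved eigenvector of \<open>T x\<close> is a combination of two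
  adjacent eigenvectors of \<open>T (x * q)\<close> (\<open>bailey_alpha_kernel_Suc\<close>). This gives the generating
  function as a single sum (\<open>durfee_op_rectangles_squares\<close>). As \<open>N\<close> tends to infinity, every
  eigenvector tends to the same infinite product, which cancels, and what remains of the functional
  equation holds because its two sides differ by a telescoping sum (\<open>lattice_term_telescopes\<close>).

  The limit is taken in formal power series in \<open>q\<close>, as a congruence modulo \<open>q ^ M\<close> that is valid for
  all large \<open>N\<close>. The exact identities for finite \<open>N\<close> have denominators; they are proved over a field,
  here the Laurent series in \<open>q\<close>. In the end \<open>x\<close> runs through the rational constants, and a
  comparison of polynomials in \<open>x\<close> recovers the number of parts.
\<close>

section \<open>Gaussian binomial coefficients\<close>

text \<open>
  The finite q-Pochhammer symbol \<open>(1 - a) (1 - a q) \<dots> (1 - a q^(n-1))\<close>. The base \<open>q\<close> itself, as the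
  argument \<open>a\<close>, gives the q-analogue of the factorial.
\<close>

definition qpoch :: "'a::comm_ring_1 \<Rightarrow> 'a \<Rightarrow> nat \<Rightarrow> 'a" where
  "qpoch a q n = (\<Prod>j<n. 1 - a * q ^ j)"

lemma qpoch_0 [simp]: "qpoch a q 0 = 1"
  by (simp add: qpoch_def)

lemma qpoch_Suc: "qpoch a q (Suc n) = qpoch a q n * (1 - a * q ^ n)"
  by (simp add: qpoch_def)

lemma qpoch_add: "qpoch a q (m + n) = qpoch a q m * qpoch (a * q ^ m) q n"
  by (induction n) (simp_all add: qpoch_Suc power_add mult_ac)

lemma qpoch_nonzero:
  fixes a q :: "'a::field"
  assumes "\<And>j. a * q ^ j \<noteq> 1"
  shows "qpoch a q n \<noteq> 0"
  using assms by (simp add: qpoch_def)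

text \<open>
  The partitions that fit into \<open>d\<close> rows of length \<open>M\<close>, padded with zero parts to \<open>d\<close> rows. The padding
  makes adding the same number to all rows injective.
\<close>

definition box :: "nat \<Rightarrow> nat \<Rightarrow> nat list set" where
  "box d M = {u. length u = d \<and> sorted_wrt (\<ge>) u \<and> (\<forall>y\<in>set u. y \<le> M)}"

text \<open>
  The Gaussian binomial coefficient \<open>[d + M choose d]\<close>.
\<close>

definition gauss :: "'a::comm_ring_1 \<Rightarrow> nat \<Rightarrow> nat \<Rightarrow> 'a" where
  "gauss q d M = (\<Sum>u\<in>box d M. q ^ sum_list u)"

lemma finite_box [simp]: "finite (box d M)"
proof (rule finite_subset)
  show "box d M \<subseteq> {u. set u \<subseteq> {..M} \<and> length u = d}"
    by (auto simp: box_def)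
qed (rule finite_lists_length_eq, simp)

lemma gauss_0_left [simp]: "gauss q 0 M = 1"
proof -
  have "box 0 M = {[]}" by (auto simp: box_def)
  then show ?thesis by (simp add: gauss_def)
qed

lemma gauss_0_right [simp]: "gauss q d 0 = 1"
proof -
  have "u = replicate d 0" if "u \<in> box d 0" for u
    by (rule replicate_eqI) (use that in \<open>simp_all add: box_def\<close>)
  moreover have "replicate d 0 \<in> box d 0"
    by (simp add: box_def sorted_wrt_iff_nth_less)
  ultimately have "box d 0 = {replicate d 0}" by blast
  then show ?thesis by (simp add: gauss_def sum_list_replicate)
qed

text \<open>
  The first row of a box partition is either full, and can be removed, or it fits into a narrower box.
\<close>

lemma gauss_Pascal:
  "gauss q (Suc d) (Suc M) = gauss q (Suc d) M + q ^ Suc M * gauss q d (Suc M)"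
proof -
  have eq: "box (Suc d) (Suc M) = box (Suc d) M \<union> (#) (Suc M) ` box d (Suc M)" (is "?L = ?R")
  proof (intro equalityI subsetI)
    fix u assume u: "u \<in> ?L"
    then obtain h t where ht: "u = h # t" by (cases u) (auto simp: box_def)
    show "u \<in> ?R"
    proof (cases "h = Suc M")
      case True
      then show ?thesis using u ht by (auto simp: box_def)
    next
      case False
      then have "h \<le> M" using u ht by (auto simp: box_def)
      then show ?thesis using u ht by (fastforce simp: box_def)
    qed
  qed (fastforce simp: box_def)
  have "box (Suc d) M \<inter> (#) (Suc M) ` box d (Suc M) = {}"
    by (fastforce simp: box_def)
  then show ?thesis
    by (simp add: gauss_def eq sum.union_disjoint sum.reindex sum_distrib_left power_add mult_ac)
qed

lemma gauss_qpoch: "gauss q d M * (qpoch q q d * qpoch q q M) = qpoch q q (d + M)"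
proof (induction "d + M" arbitrary: d M)
  case (Suc k)
  show ?case
  proof (cases "d = 0 \<or> M = 0")
    case False
    then obtain d' M' where dM: "d = Suc d'" "M = Suc M'" by (metis not0_implies_Suc)
    have 1: "gauss q (Suc d') M' * (qpoch q q (Suc d') * qpoch q q M') = qpoch q q (Suc d' + M')"
      using Suc(2) dM by (intro Suc(1)) auto
    have 2: "gauss q d' (Suc M') * (qpoch q q d' * qpoch q q (Suc M')) = qpoch q q (d' + Suc M')"
      using Suc(2) dM by (intro Suc(1)) auto
    let ?P = "qpoch q q (Suc (d' + M'))"
    have "gauss q d M * (qpoch q q d * qpoch q q M) =
        gauss q (Suc d') M' * (qpoch q q (Suc d') * qpoch q q M') * (1 - q ^ Suc M') +
        q ^ Suc M' * (gauss q d' (Suc M') * (qpoch q q d' * qpoch q q (Suc M'))) * (1 - q ^ Suc d')"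
      unfolding dM gauss_Pascal qpoch_Suc[of q q M'] qpoch_Suc[of q q d']
      by (simp add: algebra_simps)
    also have "\<dots> = ?P * (1 - q ^ Suc M') + q ^ Suc M' * ?P * (1 - q ^ Suc d')"
      by (simp only: 1 2 add_Suc add_Suc_right)
    also have "\<dots> = ?P * (1 - q * q ^ Suc (d' + M'))"
      by (simp add: algebra_simps power_add)
    finally show ?thesis by (simp add: dM qpoch_Suc mult_ac)
  qed auto
qed auto

section \<open>The Durfee operator and its eigenvectors\<close>

text \<open>
  A polynomial form of a limiting q-Vandermonde sum; it needs no division. The q-Pascal rule
  splits the sum for \<open>M + 1\<close> into the sums for \<open>M\<close> at \<open>y\<close> and at \<open>y * q\<close>, with the weights
  \<open>1 - y * q ^ (M + 1)\<close> and \<open>y * q ^ (M + 1)\<close>.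
\<close>

lemma qVandermonde:
  "(\<Sum>e\<le>M. y ^ e * q ^ (e * e) * gauss q e (M - e) * qpoch (y * q ^ Suc e) q (M - e)) = 1"
proof (induction M arbitrary: y)
  case (Suc M)
  define t where "t y M e = y ^ e * q ^ (e * e) * gauss q e (M - e) * qpoch (y * q ^ Suc e) q (M - e)"
    for y M e
  \<comment> \<open>the contribution of the second term of the q-Pascal rule\<close>
  define s where "s e = y ^ e * q ^ (e * e) * q ^ (Suc M - e) * gauss q (e - 1) (Suc M - e)
      * qpoch (y * q ^ Suc e) q (Suc M - e)" for e
  have split: "t y (Suc M) e = (1 - y * q ^ Suc M) * t y M e + (if e = 0 then 0 else s e)"
    if e: "e \<le> M" for e
  proof -
    have q: "qpoch (y * q ^ Suc e) q (Suc M - e) = qpoch (y * q ^ Suc e) q (M - e) * (1 - y * q ^ Suc M)"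
    proof -
      have "q ^ Suc e * q ^ (M - e) = q ^ Suc M" using e by (simp flip: power_add del: power_Suc)
      then show ?thesis using e by (simp add: Suc_diff_le qpoch_Suc mult.assoc)
    qed
    show ?thesis
    proof (cases e)
      case 0
      then show ?thesis using q by (simp add: t_def mult_ac)
    next
      case (Suc e')
      have "gauss q e (Suc (M - e)) = gauss q e (M - e) + q ^ Suc (M - e) * gauss q (e - 1) (Suc (M - e))"
        using gauss_Pascal[of q e' "M - e"] by (simp only: Suc diff_Suc_1)
      then have "gauss q e (Suc M - e) = gauss q e (M - e) + q ^ (Suc M - e) * gauss q (e - 1) (Suc M - e)"
        by (simp only: Suc_diff_le[OF e])
      then show ?thesis unfolding t_def s_def q using Suc by (simp add: algebra_simps)
    qed
  qed
  have last: "t y (Suc M) (Suc M) = s (Suc M)"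
    by (simp add: t_def s_def)
  have shift: "s (Suc e) = y * q ^ Suc M * t (y * q) M e" if e: "e \<le> M" for e
  proof -
    have "Suc e * Suc e + (M - e) = e + e * e + Suc M" using e by simp
    then have "q ^ (Suc e * Suc e) * q ^ (M - e) = q ^ e * q ^ (e * e) * q ^ Suc M"
      by (simp only: power_add[symmetric])
    then show ?thesis
      by (simp add: s_def t_def power_mult_distrib mult_ac del: mult_Suc mult_Suc_right)
  qed
  have "(\<Sum>e\<le>Suc M. t y (Suc M) e) =
      (\<Sum>e\<le>M. (1 - y * q ^ Suc M) * t y M e + (if e = 0 then 0 else s e)) + s (Suc M)"
    by (simp add: split last)
  also have "\<dots> = (1 - y * q ^ Suc M) * (\<Sum>e\<le>M. t y M e) + (\<Sum>e\<le>Suc M. if e = 0 then 0 else s e)"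
    by (simp add: sum.distrib sum_distrib_left)
  also have "(\<Sum>e\<le>Suc M. if e = 0 then 0 else s e) = (\<Sum>e\<le>M. s (Suc e))"
    by (subst sum.atMost_Suc_shift) simp
  also have "\<dots> = (\<Sum>e\<le>M. y * q ^ Suc M * t (y * q) M e)"
    by (simp add: shift)
  also have "(\<Sum>e\<le>M. t y M e) = 1" using Suc.IH[of y] by (simp add: t_def)
  also have "(\<Sum>e\<le>M. y * q ^ Suc M * t (y * q) M e) = y * q ^ Suc M"
    using Suc.IH[of "y * q"] by (simp add: t_def flip: sum_distrib_left)
  finally show ?case by (simp add: t_def)
qed simp

text \<open>
  The sum over the side \<open>d\<close> of the topmost Durfee square, for partitions with parts at most \<open>N\<close>.
\<close>

definition durfee_op :: "'a::comm_ring_1 \<Rightarrow> 'a \<Rightarrow> (nat \<Rightarrow> 'a) \<Rightarrow> nat \<Rightarrow> 'a" where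
  "durfee_op q x f N = (\<Sum>d\<le>N. x ^ d * q ^ (d * d) * gauss q d (N - d) * f d)"

text \<open>
  Up to the factor \<open>qpoch q q N\<close> this is the kernel of a Bailey pair relative to \<open>x\<close>.
\<close>

definition bailey_kernel :: "'a::field \<Rightarrow> 'a \<Rightarrow> nat \<Rightarrow> nat \<Rightarrow> 'a" where
  "bailey_kernel q x k N =
     (if k \<le> N then qpoch q q N / (qpoch q q (N - k) * qpoch (x * q) q (N + k)) else 0)"

text \<open>
  This is the Bailey lemma with both parameters sent to infinity. Only sides \<open>d = k + e\<close> contribute; after
  extraction of the value at \<open>N\<close>, the sum over \<open>e\<close> is the q-Vandermonde sum at \<open>y = x * q ^ (2 * k)\<close>.
\<close>

lemma durfee_op_bailey_kernel:
  fixes q x :: "'a::field"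
  assumes q: "\<And>n. q * q ^ n \<noteq> 1" and x: "\<And>n. x * q * q ^ n \<noteq> 1"
  shows "durfee_op q x (bailey_kernel q x k) N = x ^ k * q ^ (k * k) * bailey_kernel q x k N"
proof (cases "k \<le> N")
  case False
  then show ?thesis by (auto simp: durfee_op_def bailey_kernel_def intro!: sum.neutral)
next
  case True
  then obtain M where N: "N = k + M" using le_Suc_ex by blast
  have nz: "qpoch q q n \<noteq> 0" "qpoch (x * q) q n \<noteq> 0" for n
    using qpoch_nonzero[of q q] qpoch_nonzero[of "x * q" q] q x by auto
  let ?y = "x * q ^ (2 * k)"
  let ?f = "\<lambda>d. x ^ d * q ^ (d * d) * gauss q d (N - d) * bailey_kernel q x k d"
  let ?C = "x ^ k * q ^ (k * k) * bailey_kernel q x k N"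
  have summand: "?f (k + e) =
      ?C * (?y ^ e * q ^ (e * e) * gauss q e (M - e) * qpoch (?y * q ^ Suc e) q (M - e))"
    if e: "e \<le> M" for e
  proof -
    have pw: "x ^ (k + e) * q ^ ((k + e) * (k + e)) = x ^ k * q ^ (k * k) * (?y ^ e * q ^ (e * e))"
    proof -
      have "(k + e) * (k + e) = k * k + (2 * k * e + e * e)"
        by (simp add: algebra_simps)
      then have "q ^ ((k + e) * (k + e)) = q ^ (k * k) * ((q ^ (2 * k)) ^ e * q ^ (e * e))"
        by (simp only: power_add power_mult)
      then show ?thesis by (simp only: power_add[of x] power_mult_distrib mult_ac)
    qed
    have g1: "gauss q (k + e) (M - e) = qpoch q q N / (qpoch q q (k + e) * qpoch q q (M - e))"
      using gauss_qpoch[of q "k + e" "M - e"] e nz by (simp add: N eq_divide_eq)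
    have g2: "gauss q e (M - e) = qpoch q q M / (qpoch q q e * qpoch q q (M - e))"
      using gauss_qpoch[of q "e" "M - e"] e nz by (simp add: eq_divide_eq)
    have Nk: "N + k = 2 * k + e + (M - e)" using N e by simp
    have "qpoch (x * q) q (N + k) =
        qpoch (x * q) q (2 * k + e) * qpoch (x * q * q ^ (2 * k + e)) q (M - e)"
      unfolding Nk by (rule qpoch_add)
    also have "x * q * q ^ (2 * k + e) = ?y * q ^ Suc e"
      by (simp add: power_add mult_ac)
    finally have x1: "qpoch (x * q) q (N + k) =
        qpoch (x * q) q (2 * k + e) * qpoch (?y * q ^ Suc e) q (M - e)" .
    have nz': "qpoch (?y * q ^ Suc e) q (M - e) \<noteq> 0" using x1 nz(2) by (metis mult_zero_right)
    have k1: "bailey_kernel q x k (k + e) = qpoch q q (k + e) / (qpoch q q e * qpoch (x * q) q (2 * k + e))"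
      by (simp add: bailey_kernel_def mult_2 add_ac)
    have k2: "bailey_kernel q x k N = qpoch q q N / (qpoch q q M *
        (qpoch (x * q) q (2 * k + e) * qpoch (?y * q ^ Suc e) q (M - e)))"
      unfolding bailey_kernel_def x1 using N by simp
    have "gauss q (k + e) (N - (k + e)) * bailey_kernel q x k (k + e) =
        bailey_kernel q x k N * (gauss q e (M - e) * qpoch (?y * q ^ Suc e) q (M - e))"
    proof -
      have "N - (k + e) = M - e" by (simp add: N)
      then show ?thesis unfolding k1 k2 g2 using g1 nz nz' by simp
    qed
    then have "x ^ (k + e) * q ^ ((k + e) * (k + e)) *
        (gauss q (k + e) (N - (k + e)) * bailey_kernel q x k (k + e)) =
      x ^ k * q ^ (k * k) * (?y ^ e * q ^ (e * e)) *
        (bailey_kernel q x k N * (gauss q e (M - e) * qpoch (?y * q ^ Suc e) q (M - e)))"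
      using pw by (rule arg_cong2[where f = "(*)", rotated])
    then show ?thesis by (simp only: mult_ac)
  qed
  have "durfee_op q x (bailey_kernel q x k) N = sum ?f {..N}"
    by (simp add: durfee_op_def)
  also have "\<dots> = sum ?f {k..N}"
    by (rule sum.mono_neutral_right) (auto simp: bailey_kernel_def)
  also have "\<dots> = (\<Sum>e\<le>M. ?f (k + e))"
    using sum.shift_bounds_cl_nat_ivl[of ?f 0 k M] by (simp add: N atLeast0AtMost add_ac)
  also have "\<dots> = (\<Sum>e\<le>M. ?C * (?y ^ e * q ^ (e * e) * gauss q e (M - e) * qpoch (?y * q ^ Suc e) q (M - e)))"
    by (intro sum.cong refl summand) simp
  also have "\<dots> = ?C"
    by (simp only: sum_distrib_left[symmetric] qVandermonde mult_1_right)
  finally show ?thesis .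
qed

lemma durfee_op_cong:
  assumes "\<And>d. d \<le> N \<Longrightarrow> f d = g d"
  shows "durfee_op q x f N = durfee_op q x g N"
  using assms by (simp add: durfee_op_def)

lemma durfee_op_sum:
  "durfee_op q x (\<lambda>N. \<Sum>k\<in>I. c k * f k N) N = (\<Sum>k\<in>I. c k * durfee_op q x (f k) N)"
proof -
  have "durfee_op q x (\<lambda>N. \<Sum>k\<in>I. c k * f k N) N =
      (\<Sum>d\<le>N. \<Sum>k\<in>I. c k * (x ^ d * q ^ (d * d) * gauss q d (N - d) * f k d))"
    unfolding durfee_op_def sum_distrib_left by (simp only: mult_ac)
  also have "\<dots> = (\<Sum>k\<in>I. c k * durfee_op q x (f k) N)"
    unfolding durfee_op_def sum_distrib_left by (rule sum.swap)
  finally show ?thesis .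
qed

text \<open>
  Expansions are only required for arguments up to \<open>K\<close>, since \<open>durfee_op q x f N\<close> depends on \<open>f\<close> only
  up to \<open>N\<close>. This keeps all sums finite.
\<close>

lemma durfee_op_funpow_eigen:
  assumes eigen: "\<And>k N. durfee_op q x (f k) N = e k * f k N"
    and g: "\<And>N. N \<le> K \<Longrightarrow> g N = (\<Sum>k\<le>K. c k * f k N)"
    and N: "N \<le> K"
  shows "(durfee_op q x ^^ n) g N = (\<Sum>k\<le>K. c k * e k ^ n * f k N)"
  using N
proof (induction n arbitrary: N)
  case (Suc n)
  have "(durfee_op q x ^^ Suc n) g N = durfee_op q x (\<lambda>N. \<Sum>k\<le>K. c k * e k ^ n * f k N) N"
    using Suc by (auto intro!: durfee_op_cong)
  also have "\<dots> = (\<Sum>k\<le>K. c k * e k ^ n * (e k * f k N))"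
    by (simp add: durfee_op_sum eigen)
  finally show ?case by (simp add: mult_ac)
qed (simp add: g)

text \<open>
  In the summand for the side \<open>d\<close> the unit at 0 is evaluated at \<open>d\<close>, which leaves \<open>d = 0\<close>. So the constant 1,
  the generating function of the empty rest of a dissection, counts as one application of the operator.
\<close>

lemma durfee_op_delta: "durfee_op q x (\<lambda>N. if N = 0 then 1 else 0) = (\<lambda>N. 1)"
proof
  fix N
  have "durfee_op q x (\<lambda>N. if N = 0 then 1 else 0) N = (\<Sum>d\<le>N. if d = 0 then 1 else 0)"
    unfolding durfee_op_def by (rule sum.cong) auto
  then show "durfee_op q x (\<lambda>N. if N = 0 then 1 else 0) N = 1" by simp
qed

text \<open>
  The unit Bailey pair.
\<close>

definition bailey_alpha :: "'a::field \<Rightarrow> 'a \<Rightarrow> nat \<Rightarrow> 'a" where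
  "bailey_alpha q x k = (if k = 0 then 1 else
     (-1) ^ k * q ^ (\<Sum>{..<k}) * (1 - x * q ^ (2 * k)) * qpoch (x * q) q (k - 1) / qpoch q q k)"

text \<open>
  A commutative ring with an inverse operation is enough, so that the same expression makes sense both in a
  field and in formal power series, where the denominator is a unit.
\<close>

definition lattice_coeff :: "'a::{comm_ring_1,inverse} \<Rightarrow> 'a \<Rightarrow> nat \<Rightarrow> 'a" where
  "lattice_coeff q x k = (-1) ^ k * q ^ (\<Sum>{..<k}) * qpoch (x * q) q k * inverse (qpoch q q k)"

text \<open>
  The eigenvector \<open>bailey_kernel q (x * q) k\<close> of \<open>durfee_op q (x * q)\<close>, divided by \<open>1 - x * q\<close>. This
  normalization makes its limit for large \<open>N\<close> the same product as that of \<open>bailey_kernel q x k\<close>.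
\<close>

definition lattice_kernel :: "'a::field \<Rightarrow> 'a \<Rightarrow> nat \<Rightarrow> nat \<Rightarrow> 'a" where
  "lattice_kernel q x k N =
     (if k \<le> N then qpoch q q N / (qpoch q q (N - k) * qpoch (x * q) q (Suc (N + k))) else 0)"

lemma lattice_kernel_conv_bailey_kernel:
  "lattice_kernel q x k N = bailey_kernel q (x * q) k N / (1 - x * q)"
proof -
  have "qpoch (x * q) q (Suc n) = (1 - x * q) * qpoch (x * q * q) q n" for n
    using qpoch_add[of "x * q" q 1 n] by (simp add: qpoch_Suc)
  then show ?thesis by (simp add: lattice_kernel_def bailey_kernel_def mult_ac)
qed

context
  fixes q x :: "'a::field"
  assumes q: "\<And>n. q * q ^ n \<noteq> 1" and x: "\<And>n. x * q * q ^ n \<noteq> 1"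
begin

lemma denominators_nonzero: "qpoch q q n \<noteq> 0" "qpoch (x * q) q n \<noteq> 0"
  "q * q ^ n \<noteq> 1" "1 - q * q ^ n \<noteq> 0" "x * q * q ^ n \<noteq> 1" "1 - x * q * q ^ n \<noteq> 0"
  using qpoch_nonzero[of q q] qpoch_nonzero[of "x * q" q] q x by auto

text \<open>
  The partial sums telescope to a product, in which the factor \<open>1 - q ^ (N - K)\<close> makes the complete sum
  \<open>K = N\<close> vanish. With \<open>s = q ^ (K + 1)\<close> and \<open>l = q ^ (N - K - 1)\<close> the induction step amounts to
  \<open>(1 - x s s) (1 - s l) = (1 - s) (1 - x s s l) + s (1 - x s) (1 - l)\<close>.
\<close>

lemma sum_bailey_alpha_kernel:
  assumes "K \<le> N" "0 < N"
  shows "(\<Sum>k\<le>K. bailey_alpha q x k * bailey_kernel q x k N) =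
    (-1) ^ K * q ^ (\<Sum>{..<Suc K}) * qpoch (x * q) q K / qpoch q q K *
    ((1 - q ^ (N - K)) / (1 - q ^ N)) *
    (qpoch q q N / (qpoch q q (N - K) * qpoch (x * q) q (N + K)))"
  using assms(1)
proof (induction K)
  case 0
  obtain n where "N = Suc n" using assms by (cases N) auto
  then show ?case using denominators_nonzero(3)[of n] by (simp add: bailey_alpha_def bailey_kernel_def)
next
  case (Suc K)
  then obtain L where N: "N = K + Suc L" using le_Suc_ex by (metis add_Suc_shift)
  define s l where "s = q * q ^ K" and "l = q ^ L"
  define C Q P D X S where "C = qpoch (x * q) q K" and "Q = qpoch q q K" and "P = qpoch q q N"
    and "D = qpoch q q L" and "X = qpoch (x * q) q (N + K)" and "S = (-1) ^ K * q ^ (\<Sum>{..<K}) * q ^ K"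
  have qN: "q ^ N = s * l" by (simp add: N s_def l_def power_add)
  have 1: "qpoch q q (Suc L) = D * (1 - q * l)" "qpoch q q (Suc K) = Q * (1 - s)"
    "qpoch (x * q) q (Suc K) = C * (1 - x * s)"
    "qpoch (x * q) q (N + Suc K) = X * (1 - x * s * s * l)"
    by (simp_all add: D_def Q_def C_def X_def qpoch_Suc s_def l_def N power_add mult_ac)
  have 2: "q ^ (2 * Suc K) = s * s" by (simp add: s_def mult_2 power_add)
  have nz: "Q \<noteq> 0" "D \<noteq> 0" "X \<noteq> 0" "1 - s \<noteq> 0" "1 - q * l \<noteq> 0" "1 - s * l \<noteq> 0" "1 - x * s * s * l \<noteq> 0"
    using denominators_nonzero(1,2) denominators_nonzero(4)[of K] denominators_nonzero(4)[of L] denominators_nonzero(4)[of "K + L"] denominators_nonzero(6)[of "N + K"]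
    by (simp_all add: Q_def D_def X_def s_def l_def N power_add mult_ac)
  have IH: "(\<Sum>k\<le>K. bailey_alpha q x k * bailey_kernel q x k N) =
      S * C / Q * ((1 - q * l) / (1 - s * l)) * (P / (D * (1 - q * l) * X))"
    using Suc by (simp add: qN) (simp add: N S_def C_def Q_def P_def 1 X_def l_def power_add)
  have A: "bailey_alpha q x (Suc K) = - S * (1 - x * (s * s)) * C / (Q * (1 - s))"
    unfolding bailey_alpha_def 1 2 by (simp add: S_def C_def power_add mult_ac)
  have B: "bailey_kernel q x (Suc K) N = P / (D * (X * (1 - x * s * s * l)))"
    using 1(4) by (simp add: bailey_kernel_def N P_def D_def)
  have key: "S * C / Q * ((1 - q * l) / (1 - s * l)) * (P / (D * (1 - q * l) * X)) +
      - S * (1 - x * (s * s)) * C / (Q * (1 - s)) * (P / (D * (X * (1 - x * s * s * l)))) =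
      - S * s * (C * (1 - x * s)) / (Q * (1 - s)) * ((1 - l) / (1 - s * l)) *
        (P / (D * (X * (1 - x * s * s * l))))" (is "?a + ?b = ?c")
  proof -
    define F where "F = S * C * P / (Q * (1 - s) * D * X * (1 - s * l) * (1 - x * s * s * l))"
    have "?a = F * ((1 - s) * (1 - x * s * s * l))" "?b = F * (- ((1 - x * (s * s)) * (1 - s * l)))"
      "?c = F * (- (s * (1 - x * s) * (1 - l)))"
      using nz by (simp_all add: F_def divide_simps)
    moreover have "(1 - s) * (1 - x * s * s * l) + (- ((1 - x * (s * s)) * (1 - s * l))) =
        - (s * (1 - x * s) * (1 - l))" by (simp add: algebra_simps)
    ultimately show ?thesis by (simp only: distrib_left[symmetric])
  qed
  have "N - Suc K = L" by (simp add: N)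
  then show ?case
    unfolding sum.atMost_Suc IH A B key qN 1
    by (simp add: S_def s_def l_def P_def D_def power_add mult_ac)
qed

lemma bailey_alpha_unit:
  assumes "N \<le> K"
  shows "(if N = 0 then 1 else 0) = (\<Sum>k\<le>K. bailey_alpha q x k * bailey_kernel q x k N)"
proof -
  have "(\<Sum>k\<le>K. bailey_alpha q x k * bailey_kernel q x k N) =
      (\<Sum>k\<le>N. bailey_alpha q x k * bailey_kernel q x k N)"
    using assms by (intro sum.mono_neutral_right) (auto simp: bailey_kernel_def)
  also have "\<dots> = (if N = 0 then 1 else 0)"
    using sum_bailey_alpha_kernel[of N N] by (auto simp: bailey_alpha_def bailey_kernel_def)
  finally show ?thesis ..
qed

text \<open>
  The step from \<open>x\<close> to \<open>x * q\<close> in the Bailey lattice. In \<open>s = q ^ k\<close> and \<open>l = q ^ (N + 1 - k)\<close> it is the identity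
  behind \<open>sum_bailey_alpha_kernel\<close>, now read as the splitting of one kernel into two. The
  resulting coefficients at \<open>k\<close> and at \<open>k - 1\<close> are values of a single sequence.
\<close>

lemma bailey_alpha_kernel_Suc:
  "bailey_alpha q x k * bailey_kernel q x k (Suc N) =
     lattice_coeff q x k * q ^ k * lattice_kernel q x k N -
     (if k = 0 then 0 else lattice_coeff q x (k - 1) * q ^ (k - 1) * lattice_kernel q x (k - 1) N)"
proof (cases k)
  case 0
  then show ?thesis
    using denominators_nonzero by (simp add: bailey_alpha_def bailey_kernel_def lattice_coeff_def lattice_kernel_def)
next
  case k: (Suc j)
  show ?thesis
  proof (cases "j \<le> N")
    case False
    then show ?thesis by (simp add: k bailey_kernel_def lattice_kernel_def)
  next
    case True
    then obtain L where N: "N = j + L" using le_Suc_ex by blast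
    define s l where "s = q * q ^ j" and "l = q ^ L"
    define C Q P D X S where "C = qpoch (x * q) q j" and "Q = qpoch q q j" and "P = qpoch q q N"
      and "D = qpoch q q L" and "X = qpoch (x * q) q (Suc (N + j))"
      and "S = (-1) ^ j * q ^ (\<Sum>{..<j}) * q ^ j"
    have 1: "qpoch q q (Suc j) = Q * (1 - s)" "qpoch (x * q) q (Suc j) = C * (1 - x * s)"
      "qpoch (x * q) q (Suc (Suc (N + j))) = X * (1 - x * s * s * l)"
      "qpoch q q (Suc N) = P * (1 - s * l)"
      by (simp_all add: P_def Q_def C_def X_def qpoch_Suc s_def l_def N power_add mult_ac)
    have 2: "q ^ (2 * Suc j) = s * s" by (simp add: s_def mult_2 power_add)
    have nz: "Q \<noteq> 0" "D \<noteq> 0" "X \<noteq> 0" "1 - s \<noteq> 0" "1 - x * s * s * l \<noteq> 0"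
      using denominators_nonzero(1,2) denominators_nonzero(4)[of j] denominators_nonzero(6)[of "Suc (N + j)"]
      by (simp_all add: Q_def D_def X_def s_def l_def N power_add mult_ac)
    have A: "bailey_alpha q x k = - S * (1 - x * (s * s)) * C / (Q * (1 - s))"
      unfolding bailey_alpha_def k 1 2 by (simp add: S_def C_def power_add mult_ac)
    have B: "bailey_kernel q x k (Suc N) = P * (1 - s * l) / (D * (X * (1 - x * s * s * l)))"
      using 1(3,4) by (simp add: k bailey_kernel_def N P_def D_def)
    have c1: "lattice_coeff q x k * q ^ k = - S * s * (C * (1 - x * s)) / (Q * (1 - s))"
      unfolding lattice_coeff_def k 1 by (simp add: S_def s_def power_add mult_ac divide_inverse)
    have c2: "lattice_coeff q x j * q ^ j = S * C / Q"
      unfolding lattice_coeff_def by (simp add: S_def C_def Q_def power_add mult_ac divide_inverse)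
    have k1: "lattice_kernel q x k N = P * (1 - l) / (D * (X * (1 - x * s * s * l)))"
    proof (cases L)
      case 0
      then show ?thesis by (simp add: lattice_kernel_def k N l_def)
    next
      case (Suc L')
      have "D = qpoch q q L' * (1 - l)" by (simp add: D_def Suc qpoch_Suc l_def)
      moreover have "1 - l \<noteq> 0" using denominators_nonzero(4)[of L'] by (simp add: l_def Suc)
      ultimately show ?thesis using 1(3) Suc denominators_nonzero(1)[of L']
        by (simp add: lattice_kernel_def k N P_def)
    qed
    have k2: "lattice_kernel q x j N = P / (D * X)"
      by (simp add: lattice_kernel_def N P_def D_def X_def)
    define F where "F = S * C * P / (Q * (1 - s) * D * X * (1 - x * s * s * l))"
    have "bailey_alpha q x k * bailey_kernel q x k (Suc N) = F * (- ((1 - x * (s * s)) * (1 - s * l)))"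
      "lattice_coeff q x k * q ^ k * lattice_kernel q x k N = F * (- (s * (1 - x * s) * (1 - l)))"
      "lattice_coeff q x j * q ^ j * lattice_kernel q x j N = F * ((1 - s) * (1 - x * s * s * l))"
      unfolding A B c1 c2 k1 k2 using nz by (simp_all add: F_def divide_simps)
    moreover have "- ((1 - x * (s * s)) * (1 - s * l)) =
        - (s * (1 - x * s) * (1 - l)) - (1 - s) * (1 - x * s * s * l)" by (simp add: algebra_simps)
    ultimately have "bailey_alpha q x k * bailey_kernel q x k (Suc N) =
        lattice_coeff q x k * q ^ k * lattice_kernel q x k N -
        lattice_coeff q x j * q ^ j * lattice_kernel q x j N"
      by (simp only: right_diff_distrib)
    then show ?thesis by (simp add: k)
  qed
qed

lemma durfee_op_squares:
  assumes "N \<le> K"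
  shows "(durfee_op q x ^^ b) (\<lambda>_. 1) N =
    (\<Sum>k\<le>K. bailey_alpha q x k * (x ^ k * q ^ (k * k)) ^ Suc b * bailey_kernel q x k N)"
proof -
  have "(durfee_op q x ^^ b) (\<lambda>_. 1) = (durfee_op q x ^^ Suc b) (\<lambda>N. if N = 0 then 1 else 0)"
    by (simp add: durfee_op_delta funpow_Suc_right del: funpow.simps)
  then show ?thesis
    using durfee_op_funpow_eigen[OF durfee_op_bailey_kernel[OF q x] bailey_alpha_unit assms]
    by (simp only:)
qed

text \<open>
  Summation by parts moves the second kernel from \<open>k - 1\<close> to \<open>k\<close>, which makes the powers of two adjacent
  eigenvalues appear as a difference.
\<close>

lemma durfee_op_squares_Suc:
  assumes N: "N \<le> K"
  shows "(durfee_op q x ^^ b) (\<lambda>_. 1) (Suc N) =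
    (\<Sum>k\<le>K. lattice_coeff q x k * q ^ k * ((x ^ k * q ^ (k * k)) ^ Suc b -
       (x ^ Suc k * q ^ (Suc k * Suc k)) ^ Suc b) * lattice_kernel q x k N)"
proof -
  let ?e = "\<lambda>k. (x ^ k * q ^ (k * k)) ^ Suc b"
  let ?g = "\<lambda>k. lattice_coeff q x k * q ^ k * lattice_kernel q x k N"
  have "(durfee_op q x ^^ b) (\<lambda>_. 1) (Suc N) =
      (\<Sum>k\<le>Suc K. ?e k * (bailey_alpha q x k * bailey_kernel q x k (Suc N)))"
    using durfee_op_squares[of "Suc N" "Suc K" b] N by (simp only: mult_ac Suc_le_mono)
  also have "\<dots> = (\<Sum>k\<le>Suc K. ?e k * ?g k - (if k = 0 then 0 else ?e k * ?g (k - 1)))"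
    unfolding bailey_alpha_kernel_Suc by (rule sum.cong) (simp_all add: right_diff_distrib)
  also have "\<dots> = (\<Sum>k\<le>Suc K. ?e k * ?g k) - (\<Sum>k\<le>Suc K. if k = 0 then 0 else ?e k * ?g (k - 1))"
    by (rule sum_subtractf)
  also have "(\<Sum>k\<le>Suc K. ?e k * ?g k) = (\<Sum>k\<le>K. ?e k * ?g k)"
    using N by (simp add: lattice_kernel_def)
  also have "(\<Sum>k\<le>Suc K. if k = 0 then 0 else ?e k * ?g (k - 1)) = (\<Sum>k\<le>K. ?e (Suc k) * ?g k)"
    by (subst sum.atMost_Suc_shift) simp
  also have "(\<Sum>k\<le>K. ?e k * ?g k) - (\<Sum>k\<le>K. ?e (Suc k) * ?g k) =
      (\<Sum>k\<le>K. (?e k - ?e (Suc k)) * ?g k)"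
    by (simp only: sum_subtractf[symmetric] left_diff_distrib)
  finally show ?thesis by (simp only: mult_ac)
qed

end

text \<open>
  The \<open>k\<close>-th summand of Andrews' alternating series for the Andrews--Gordon generating function. It
  vanishes for \<open>i = 0\<close>, the initial value of the functional equation.
\<close>

definition lattice_term :: "'a::{comm_ring_1,inverse} \<Rightarrow> nat \<Rightarrow> nat \<Rightarrow> 'a \<Rightarrow> nat \<Rightarrow> 'a" where
  "lattice_term q r i x k = lattice_coeff q x k * q ^ k *
     ((x ^ k * q ^ (k * k)) ^ i - (x ^ Suc k * q ^ (Suc k * Suc k)) ^ i) *
     ((x * q) ^ k * q ^ (k * k)) ^ (r - i)"

lemma durfee_op_rectangles_squares:
  fixes q x :: "'a::field"
  assumes q: "\<And>n. q * q ^ n \<noteq> 1" and x: "\<And>n. x * q * q ^ n \<noteq> 1"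
    and i: "1 \<le> i" "i \<le> r"
  shows "(durfee_op q (x * q) ^^ (r - i)) (\<lambda>N. (durfee_op q x ^^ (i - 1)) (\<lambda>_. 1) (Suc N)) N =
    (\<Sum>k\<le>N. lattice_term q r i x k * lattice_kernel q x k N)"
proof -
  have xq: "x * q * q * q ^ n \<noteq> 1" for n
    using x[of "Suc n"] by (simp add: mult_ac)
  have eigen: "durfee_op q (x * q) (lattice_kernel q x k) M =
      (x * q) ^ k * q ^ (k * k) * lattice_kernel q x k M" for k M
    using durfee_op_sum[where I = "{k}" and c = "\<lambda>_. inverse (1 - x * q)"
        and f = "bailey_kernel q (x * q)" and q = q and x = "x * q" and N = M]
      durfee_op_bailey_kernel[OF q xq, of k M]
    by (simp add: lattice_kernel_conv_bailey_kernel[abs_def] divide_inverse mult_ac)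
  have "Suc (i - 1) = i" using i by simp
  then show ?thesis
    using durfee_op_funpow_eigen[OF eigen durfee_op_squares_Suc[OF q x, where b = "i - 1"] order.refl, of N "r - i"]
    by (simp only: lattice_term_def)
qed

section \<open>Functional equation of the generating functions\<close>

text \<open>
  Applied to \<open>N\<close>, this will be the generating function of the partitions with parts at most \<open>N + 1\<close> that
  are exhausted by \<open>r - i\<close> rectangles and then \<open>i - 1\<close> squares.
\<close>

definition rect_square_gf :: "'a::comm_ring_1 \<Rightarrow> nat \<Rightarrow> nat \<Rightarrow> 'a \<Rightarrow> nat \<Rightarrow> 'a" where
  "rect_square_gf q r i x =
     (durfee_op q (x * q) ^^ (r - i)) (\<lambda>N. (durfee_op q x ^^ (i - 1)) (\<lambda>_. 1) (Suc N))"

lemma fps_to_fls_sum: "fps_to_fls (\<Sum>k\<in>A. f k) = (\<Sum>k\<in>A. fps_to_fls (f k))"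
  by (induction A rule: infinite_finite_induct) simp_all

lemma fps_to_fls_qpoch:
  "fps_to_fls (qpoch a q n) = qpoch (fps_to_fls a) (fps_to_fls q) n"
  by (induction n) (simp_all add: qpoch_Suc fls_times_fps_to_fls fps_to_fls_power)

lemma fps_to_fls_durfee_op:
  "fps_to_fls (durfee_op q x f N) = durfee_op (fps_to_fls q) (fps_to_fls x) (\<lambda>N. fps_to_fls (f N)) N"
  by (simp add: durfee_op_def gauss_def fps_to_fls_sum fls_times_fps_to_fls fps_to_fls_power)

lemma fps_to_fls_durfee_op_funpow:
  "fps_to_fls ((durfee_op q x ^^ n) f N) =
     (durfee_op (fps_to_fls q) (fps_to_fls x) ^^ n) (\<lambda>N. fps_to_fls (f N)) N"
  by (induction n arbitrary: N) (simp_all add: fps_to_fls_durfee_op)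

lemma qpoch_X_nth_0: "qpoch (a * fps_X) (fps_X :: 'a::field fps) n $ 0 = 1"
  by (induction n) (simp_all add: qpoch_Suc)

lemma fps_to_fls_inverse_qpoch:
  fixes q :: "'a::field fps"
  defines "q \<equiv> fps_X"
  shows "fps_to_fls (inverse (qpoch q q k)) = inverse (fps_to_fls (qpoch q q k))"
proof -
  have "qpoch q q k $ 0 \<noteq> 0" using qpoch_X_nth_0[of "1 :: 'a fps" k] by (simp add: q_def)
  then have "inverse (qpoch q q k) * qpoch q q k = 1" by (rule inverse_mult_eq_1)
  then have "fps_to_fls (inverse (qpoch q q k)) * fps_to_fls (qpoch q q k) = 1"
    by (simp flip: fls_times_fps_to_fls)
  then show ?thesis by (metis inverse_unique mult.commute)
qed

lemma fps_to_fls_lattice_term: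
  fixes q :: "'a::field fps"
  defines "q \<equiv> fps_X"
  shows "fps_to_fls (lattice_term q r i x k) = lattice_term (fps_to_fls q) r i (fps_to_fls x) k"
  using fps_to_fls_inverse_qpoch[of k, where ?'a = 'a]
  by (simp add: lattice_term_def lattice_coeff_def fls_times_fps_to_fls fps_to_fls_power
      fps_to_fls_qpoch q_def)

text \<open>
  Multiplication with a Pochhammer symbol that is a common multiple of the denominators
  brings the expansion in kernels back from Laurent series to power series.
\<close>

lemma rect_square_gf_fps:
  fixes q x :: "'a::field fps"
  defines "q \<equiv> fps_X"
  assumes i: "1 \<le> i" "i \<le> r"
  shows "rect_square_gf q r i x N * qpoch (x * q) q (Suc (2 * N)) =
    (\<Sum>k\<le>N. lattice_term q r i x k *
       (qpoch (q * q ^ (N - k)) q k * qpoch (x * q * q ^ Suc (N + k)) q (N - k)))" (is "?L = ?R")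
proof -
  let ?f = fps_to_fls
  have ne1: "?f (z * q) \<noteq> 1" for z
  proof
    assume "?f (z * q) = 1"
    then have "z * q = 1" by simp
    then have "(z * q) $ 0 = 1" by simp
    then show False by (simp add: q_def)
  qed
  have fq: "?f q * ?f q ^ n \<noteq> 1" for n
    using ne1[of "q ^ n"] by (simp add: fls_times_fps_to_fls fps_to_fls_power mult_ac)
  have fx: "?f x * ?f q * ?f q ^ n \<noteq> 1" for n
    using ne1[of "x * q ^ n"] by (simp add: fls_times_fps_to_fls fps_to_fls_power mult_ac)
  have kern: "lattice_kernel (?f q) (?f x) k N * ?f (qpoch (x * q) q (Suc (2 * N))) =
      ?f (qpoch (q * q ^ (N - k)) q k * qpoch (x * q * q ^ Suc (N + k)) q (N - k))"
    if k: "k \<le> N" for k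
  proof -
    have "Suc (2 * N) = Suc (N + k) + (N - k)" using k by simp
    then have 1: "qpoch (x * q) q (Suc (2 * N)) =
        qpoch (x * q) q (Suc (N + k)) * qpoch (x * q * q ^ Suc (N + k)) q (N - k)"
      by (simp only: qpoch_add)
    have 2: "qpoch q q N = qpoch q q (N - k) * qpoch (q * q ^ (N - k)) q k"
      using qpoch_add[of q q "N - k" k] k by simp
    have "qpoch (?f q) (?f q) (N - k) \<noteq> 0" "qpoch (?f x * ?f q) (?f q) (Suc (N + k)) \<noteq> 0"
      using fq fx by (auto intro!: qpoch_nonzero)
    then have nz: "?f (qpoch q q (N - k)) \<noteq> 0" "?f (qpoch (x * q) q (Suc (N + k))) \<noteq> 0"
      by (simp_all only: fps_to_fls_qpoch fls_times_fps_to_fls not_False_eq_True)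
    have "lattice_kernel (?f q) (?f x) k N =
        ?f (qpoch q q N) / (?f (qpoch q q (N - k)) * ?f (qpoch (x * q) q (Suc (N + k))))"
      using k by (simp add: lattice_kernel_def fps_to_fls_qpoch fls_times_fps_to_fls)
    then show ?thesis
      unfolding 1 2 fls_times_fps_to_fls using nz by simp
  qed
  have "?f ?L = (\<Sum>k\<le>N. lattice_term (?f q) r i (?f x) k * lattice_kernel (?f q) (?f x) k N) *
      ?f (qpoch (x * q) q (Suc (2 * N)))"
    using durfee_op_rectangles_squares[OF fq fx i, of N]
    by (simp only: rect_square_gf_def fps_to_fls_durfee_op_funpow fls_times_fps_to_fls fps_one_to_fls)
  also have "\<dots> = (\<Sum>k\<le>N. ?f (lattice_term q r i x k *
      (qpoch (q * q ^ (N - k)) q k * qpoch (x * q * q ^ Suc (N + k)) q (N - k))))"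
    unfolding sum_distrib_right
  proof (rule sum.cong)
    fix k assume "k \<in> {..N}"
    then show "lattice_term (?f q) r i (?f x) k * lattice_kernel (?f q) (?f x) k N *
        ?f (qpoch (x * q) q (Suc (2 * N))) = ?f (lattice_term q r i x k *
        (qpoch (q * q ^ (N - k)) q k * qpoch (x * q * q ^ Suc (N + k)) q (N - k)))"
      using kern[of k] fps_to_fls_lattice_term[of r i x k]
      by (simp only: q_def mult.assoc atMost_iff fls_times_fps_to_fls[of "lattice_term _ _ _ _ _"])
  qed simp
  also have "\<dots> = ?f ?R" by (rule fps_to_fls_sum[symmetric])
  finally show ?thesis by (simp only: fps_to_fls_eq_iff)
qed

lemma dvd_qpoch_minus_1:
  assumes "m dvd a"
  shows "m dvd qpoch a q n - 1"
proof (induction n)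
  case (Suc n)
  have "qpoch a q (Suc n) - 1 = (qpoch a q n - 1) - a * (qpoch a q n * q ^ n)"
    by (simp add: qpoch_Suc algebra_simps)
  then show ?case using Suc assms by (simp only: dvd_diff dvd_mult2)
qed simp

text \<open>
  Modulo \<open>q ^ M\<close> the terms with \<open>k \<ge> M\<close> vanish. For \<open>k < M\<close> and \<open>N \<ge> 2 * M\<close>, all factors that depend on \<open>N\<close>
  are of the form \<open>1 - a * q ^ j\<close> with \<open>j \<ge> M\<close>.
\<close>

lemma rect_square_gf_limit:
  fixes q x :: "'a::field fps"
  defines "q \<equiv> fps_X"
  assumes i: "1 \<le> i" "i \<le> r" and N: "2 * M \<le> N"
  shows "q ^ M dvd rect_square_gf q r i x N * qpoch (x * q) q M - (\<Sum>k<M. lattice_term q r i x k)"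
proof -
  \<comment> \<open>the factors that become 1 in the limit: \<open>U\<close> from the denominator, \<open>W k\<close> from the kernel\<close>
  define U where "U = qpoch (x * q * q ^ M) q (Suc (2 * N) - M)"
  define W where "W k = qpoch (q * q ^ (N - k)) q k * qpoch (x * q * q ^ Suc (N + k)) q (N - k)" for k
  let ?G = "rect_square_gf q r i x N * qpoch (x * q) q M" and ?t = "lattice_term q r i x"
  have le: "q ^ M dvd q ^ n" if "M \<le> n" for n
    using that by (rule le_imp_power_dvd)
  have U: "q ^ M dvd U - 1"
    unfolding U_def by (intro dvd_qpoch_minus_1) simp
  have "qpoch (x * q) q (Suc (2 * N)) = qpoch (x * q) q M * U"
    using N qpoch_add[of "x * q" q M "Suc (2 * N) - M"] by (simp add: U_def)
  then have G: "?G * U = (\<Sum>k\<le>N. ?t k * W k)"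
    using rect_square_gf_fps[OF i, of x N] by (simp add: q_def W_def mult.assoc)
  have W: "q ^ M dvd W k - 1" if k: "k < M" for k
  proof -
    let ?a = "qpoch (q * q ^ (N - k)) q k" and ?b = "qpoch (x * q * q ^ Suc (N + k)) q (N - k)"
    have "q ^ M dvd ?a - 1" "q ^ M dvd ?b - 1"
      using k N by (auto intro!: dvd_qpoch_minus_1 dvd_mult le)
    then have "q ^ M dvd (?a - 1) * ?b + (?b - 1)" by (intro dvd_add dvd_mult2)
    moreover have "W k - 1 = (?a - 1) * ?b + (?b - 1)" by (simp add: W_def algebra_simps)
    ultimately show ?thesis by (simp only:)
  qed
  have split: "{..N} = {..<M} \<union> {M..N}" using N by auto
  have "(\<Sum>k\<le>N. ?t k * W k) - (\<Sum>k<M. ?t k) = (\<Sum>k<M. ?t k * (W k - 1)) + (\<Sum>k=M..N. ?t k * W k)"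
    unfolding split by (subst sum.union_disjoint) (auto simp: sum_subtractf right_diff_distrib)
  moreover have "q ^ M dvd (\<Sum>k<M. ?t k * (W k - 1))"
    using W by (intro dvd_sum dvd_mult) auto
  moreover have "q ^ M dvd ?t k * W k" if "M \<le> k" for k
    unfolding lattice_term_def using le[OF that] by (intro dvd_mult2 dvd_mult)
  then have "q ^ M dvd (\<Sum>k=M..N. ?t k * W k)"
    by (intro dvd_sum) auto
  ultimately have "q ^ M dvd ?G * U - (\<Sum>k<M. ?t k)"
    unfolding G by simp
  moreover have "?G - (\<Sum>k<M. ?t k) = (?G * U - (\<Sum>k<M. ?t k)) - ?G * (U - 1)"
    by (simp add: right_diff_distrib)
  ultimately show ?thesis using U by (metis dvd_diff dvd_mult)
qed

lemma lattice_coeff_Suc: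
  fixes q x :: "'a::field fps"
  defines "q \<equiv> fps_X"
  shows "lattice_coeff q x (Suc k) * (1 - q * q ^ k) = - lattice_coeff q x k * q ^ k * (1 - x * q * q ^ k)"
proof -
  have "(1 - q * q ^ k) $ 0 \<noteq> 0" by (simp add: q_def)
  then have "inverse (1 - q * q ^ k) * (1 - q * q ^ k) = 1" by (rule inverse_mult_eq_1)
  then have "inverse (qpoch q q (Suc k)) * (1 - q * q ^ k) = inverse (qpoch q q k)"
    by (simp only: qpoch_Suc fps_inverse_mult mult.assoc mult_1_right)
  moreover have "lattice_coeff q x (Suc k) * (1 - q * q ^ k) =
      (-1) ^ Suc k * q ^ (\<Sum>{..<Suc k}) * qpoch (x * q) q (Suc k) *
        (inverse (qpoch q q (Suc k)) * (1 - q * q ^ k))"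
    by (simp only: lattice_coeff_def mult.assoc)
  ultimately show ?thesis
    by (simp add: lattice_coeff_def qpoch_Suc power_add mult_ac)
qed

lemma lattice_coeff_shift:
  "lattice_coeff q (x * q) k * (1 - x * q) = lattice_coeff q x k * (1 - x * q * q ^ k)"
proof -
  have "(1 - x * q) * qpoch (x * q * q) q k = qpoch (x * q) q k * (1 - x * q * q ^ k)"
    using qpoch_add[of "x * q" q 1 k] qpoch_Suc[of "x * q" q k] by (simp add: qpoch_Suc)
  then have "qpoch (x * q * q) q k * (1 - x * q) = qpoch (x * q) q k * (1 - x * q * q ^ k)"
    by (simp only: mult.commute)
  moreover have "lattice_coeff q (x * q) k * (1 - x * q) = (-1) ^ k * q ^ (\<Sum>{..<k}) *
      (qpoch (x * q * q) q k * (1 - x * q)) * inverse (qpoch q q k)"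
    by (simp only: lattice_coeff_def mult_ac)
  ultimately show ?thesis by (simp only: lattice_coeff_def mult_ac)
qed

text \<open>
  The combination of terms at \<open>k\<close> in the functional equation does not vanish by itself. With
  \<open>u = x ^ k * q ^ (k * k)\<close>, \<open>c = q ^ k\<close> and \<open>v = u * x * q * c * c\<close>, the first two terms
  leave a multiple of \<open>1 - c\<close>, with the power \<open>u ^ i\<close>, and a multiple of \<open>1 - x * q * c\<close>, with the power
  \<open>v ^ (i - 1)\<close>. The latter cancels against half of the third term, and the other half is the former with
  \<open>k + 1\<close> instead of \<open>k\<close>.
\<close>

lemma lattice_term_telescopes:
  fixes q x :: "'a::field fps"
  defines "q \<equiv> fps_X"
  assumes i: "1 \<le> i" "i \<le> r"
  defines "L \<equiv> \<lambda>k. lattice_coeff q x k * (1 - q ^ k) * q ^ k *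
      (x ^ k * q ^ (k * k)) ^ i * ((x * q) ^ k * q ^ (k * k)) ^ (r - i)"
  shows "lattice_term q r i x k - lattice_term q r (i - 1) x k -
    (x * q) ^ (i - 1) * (1 - x * q) * lattice_term q r (Suc (r - i)) (x * q) k = L k - L (Suc k)"
proof -
  obtain a b where i': "i = Suc b" and r: "r = Suc b + a"
    using i by (metis Suc_le_D One_nat_def le_Suc_ex)
  define u v c g where "u = x ^ k * q ^ (k * k)" and "v = x ^ Suc k * q ^ (Suc k * Suc k)"
    and "c = q ^ k" and "g = lattice_coeff q x k"
  have v: "v = x * q * c * c * u"
    by (simp add: v_def u_def c_def power_add mult_ac)
  have uq: "(x * q) ^ k * q ^ (k * k) = u * c" "(x * q * q) ^ k * q ^ (k * k) = u * c * c"
    "(x * q) ^ Suc k * q ^ (Suc k * Suc k) = v * q * c"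
    by (simp_all add: u_def v_def c_def power_mult_distrib mult_ac)
  have sub: "r - i = a" "r - (i - 1) = Suc a" "i - 1 = b" "r - Suc (r - i) = b" "r - b = Suc a" "r - Suc a = b"
    by (simp_all add: i' r)
  have t1: "lattice_term q r i x k = g * c * (u ^ Suc b - v ^ Suc b) * (u * c) ^ a"
    by (simp only: lattice_term_def sub uq) (simp only: g_def c_def u_def v_def i')
  have t2: "lattice_term q r (i - 1) x k = g * c * (u ^ b - v ^ b) * (u * c) ^ Suc a"
    by (simp only: lattice_term_def sub uq) (simp only: g_def c_def u_def v_def)
  have "(1 - x * q) * lattice_term q r (Suc (r - i)) (x * q) k =
      (lattice_coeff q (x * q) k * (1 - x * q)) * c * ((u * c) ^ Suc a - (v * q * c) ^ Suc a) * (u * c * c) ^ b"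
    unfolding lattice_term_def sub uq c_def by (simp only: mult_ac)
  then have t3: "(1 - x * q) * lattice_term q r (Suc (r - i)) (x * q) k =
      (g * (1 - x * q * c)) * c * ((u * c) ^ Suc a - (v * q * c) ^ Suc a) * (u * c * c) ^ b"
    by (simp only: lattice_coeff_shift g_def c_def)
  have L0: "L k = g * (1 - c) * c * u ^ Suc b * (u * c) ^ a"
    by (simp only: L_def sub uq) (simp only: g_def c_def u_def i')
  have "L (Suc k) = (lattice_coeff q x (Suc k) * (1 - q * q ^ k)) * (q * c) * v ^ Suc b * (v * q * c) ^ a"
    by (simp only: L_def sub uq) (simp only: v_def i' c_def power_Suc)
  then have L1: "L (Suc k) = (- g * c * (1 - x * q * c)) * (q * c) * v ^ Suc b * (v * q * c) ^ a"
    using lattice_coeff_Suc[of x k] by (simp only: q_def g_def c_def)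
  have e1: "(x * q) ^ b * (u * c * c) ^ b = v ^ b"
    by (simp add: v power_mult_distrib mult_ac)
  have "(x * q) ^ b * (1 - x * q) * lattice_term q r (Suc (r - i)) (x * q) k =
      g * (1 - x * q * c) * c * ((u * c) ^ Suc a - (v * q * c) ^ Suc a) * ((x * q) ^ b * (u * c * c) ^ b)"
    using t3 by (simp only: mult.assoc) (simp only: mult_ac)
  then have t4: "(x * q) ^ b * (1 - x * q) * lattice_term q r (Suc (r - i)) (x * q) k =
      g * (1 - x * q * c) * c * ((u * c) ^ Suc a - (v * q * c) ^ Suc a) * v ^ b"
    by (simp only: e1)
  have 1: "g * c * (u ^ Suc b - v ^ Suc b) * (u * c) ^ a - g * c * (u ^ b - v ^ b) * (u * c) ^ Suc a =
      g * (1 - c) * c * u ^ Suc b * (u * c) ^ a + g * (1 - x * q * c) * c * (u * c) ^ Suc a * v ^ b"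
    by (simp add: v algebra_simps)
  show ?thesis
    unfolding t1 t2 unfolding sub(3) t4 L0 L1 1 by (simp add: algebra_simps)
qed

text \<open>
  The generating functions have the same limiting denominator, since
  \<open>(1 - x * q) * qpoch (x * q * q) q M\<close> is congruent to \<open>qpoch (x * q) q M\<close>. It is a unit and cancels.
\<close>

lemma rect_square_gf_functional_eq:
  fixes q x :: "'a::field fps"
  defines "q \<equiv> fps_X"
  assumes i: "1 \<le> i" "i \<le> r" and N: "2 * M \<le> N"
  shows "q ^ M dvd rect_square_gf q r i x N - (if i = 1 then 0 else rect_square_gf q r (i - 1) x N) -
    (x * q) ^ (i - 1) * rect_square_gf q r (Suc (r - i)) (x * q) N"
proof -
  define U where "U = qpoch (x * q) q M"
  define A where "A = rect_square_gf q r i x N"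
  define A' where "A' = (if i = 1 then 0 else rect_square_gf q r (i - 1) x N)"
  define B where "B = rect_square_gf q r (Suc (r - i)) (x * q) N"
  define J J' J'' where "J = (\<Sum>k<M. lattice_term q r i x k)"
    and "J' = (\<Sum>k<M. lattice_term q r (i - 1) x k)"
    and "J'' = (\<Sum>k<M. lattice_term q r (Suc (r - i)) (x * q) k)"
  define V where "V = qpoch (x * q * q) q M"
  let ?y = "(x * q) ^ (i - 1)"
  have 1: "q ^ M dvd A * U - J"
    unfolding A_def U_def J_def q_def by (rule rect_square_gf_limit[OF i N])
  have 2: "q ^ M dvd A' * U - J'"
  proof (cases "i = 1")
    case True
    then show ?thesis by (simp add: A'_def J'_def lattice_term_def)
  next
    case False
    then show ?thesis
      using rect_square_gf_limit[of "i - 1" r M N x] i N by (simp add: A'_def U_def J'_def q_def)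
  qed
  have 3: "q ^ M dvd B * V - J''"
    using rect_square_gf_limit[of "Suc (r - i)" r M N "x * q"] i N by (simp add: B_def V_def J''_def q_def)
  define L where "L k = lattice_coeff q x k * (1 - q ^ k) * q ^ k *
      (x ^ k * q ^ (k * k)) ^ i * ((x * q) ^ k * q ^ (k * k)) ^ (r - i)" for k
  have "J - J' - ?y * (1 - x * q) * J'' = (\<Sum>k<M. L k - L (Suc k))"
    unfolding J_def J'_def J''_def sum_distrib_left sum_subtractf[symmetric]
    unfolding L_def q_def by (intro sum.cong refl lattice_term_telescopes i)
  also have "\<dots> = - L M"
    by (subst sum_lessThan_telescope') (simp add: L_def)
  finally have J: "J - J' - ?y * (1 - x * q) * J'' = - L M" .
  have 4: "q ^ M dvd L M"
    unfolding L_def by (intro dvd_mult2 dvd_mult dvd_refl)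
  have "(1 - x * q) * V = U * (1 - x * q * q ^ M)"
    using qpoch_add[of "x * q" q 1 M] qpoch_Suc[of "x * q" q M] by (simp add: U_def V_def qpoch_Suc)
  then have V: "(1 - x * q) * V - U = q ^ M * (- U * x * q)"
    by (simp add: algebra_simps)
  \<comment> \<open>each generating function, multiplied by its denominator, is replaced by its series up to a
    multiple of \<open>q ^ M\<close>; the fourth term exchanges the denominators at \<open>x * q\<close> and at \<open>x\<close>\<close>
  have "(A - A' - ?y * B) * U = (A * U - J) - (A' * U - J') - ?y * (1 - x * q) * (B * V - J'') +
      ?y * B * ((1 - x * q) * V - U) + (J - J' - ?y * (1 - x * q) * J'')"
    by (simp add: algebra_simps)
  also have "q ^ M dvd \<dots>"
  proof -
    have 5: "q ^ M dvd ?y * B * ((1 - x * q) * V - U)"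
      unfolding V by (intro dvd_mult dvd_triv_left)
    have 6: "q ^ M dvd J - J' - ?y * (1 - x * q) * J''"
      using 4 by (simp only: J dvd_minus_iff)
    show ?thesis
      by (rule dvd_add[OF dvd_add[OF dvd_diff[OF dvd_diff[OF 1 2] dvd_mult[OF 3]] 5] 6])
  qed
  finally have "q ^ M dvd (A - A' - ?y * B) * U" .
  moreover have "U dvd 1"
    using qpoch_X_nth_0[of x M] by (simp add: U_def q_def)
  ultimately have "q ^ M dvd A - A' - ?y * B"
    by (simp add: dvd_mult_unit_iff)
  then show ?thesis by (simp only: A_def A'_def B_def)
qed

section \<open>Generating functions of partitions by their Durfee dissections\<close>

text \<open>
  Together with \<open>durfee_rows_split\<close> this replaces the maximum in the definition of a Durfee rectangle by
  inequalities between parts: the cut is the one at which the parts above are at least, and the parts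
  below at most, as large as the width of the rectangle.
\<close>

lemma durfee_rows_append:
  assumes u: "\<forall>y\<in>set u. length u + e \<le> y" and v: "\<forall>y\<in>set v. y \<le> length u + e"
  shows "durfee_rows e (u @ v) = length u"
  unfolding durfee_rows_def
proof (rule Max_eqI[OF finite_durfee])
  fix d assume "d \<in> {d. {..<d} \<times> {..<d + e} \<subseteq> young_diagram (u @ v)}"
  then have d: "{..<d} \<times> {..<d + e} \<subseteq> young_diagram (u @ v)" by simp
  show "d \<le> length u"
  proof (rule ccontr)
    assume "\<not> d \<le> length u"
    then have "(length u, d + e - 1) \<in> young_diagram (u @ v)" using d by auto
    then have "0 < length v" "d + e - 1 < v ! 0"
      by (auto simp: young_diagram_def nth_append)
    moreover have "v ! 0 \<le> length u + e" using v \<open>0 < length v\<close> by simp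
    ultimately show False using \<open>\<not> d \<le> length u\<close> by simp
  qed
next
  show "length u \<in> {d. {..<d} \<times> {..<d + e} \<subseteq> young_diagram (u @ v)}"
    using u by (auto simp: young_diagram_def nth_append dest!: bspec[OF _ nth_mem])
qed

lemma durfee_rows_split:
  fixes e :: nat
  assumes p: "sorted_wrt (\<ge>) p"
  defines "d \<equiv> durfee_rows e p"
  shows "d \<le> length p" "\<forall>y\<in>set (take d p). d + e \<le> y" "\<forall>y\<in>set (drop d p). y \<le> d + e"
proof -
  have "0 \<in> {d. {..<d} \<times> {..<d + e} \<subseteq> young_diagram p}" by simp
  then have "d \<in> {d. {..<d} \<times> {..<d + e} \<subseteq> young_diagram p}"
    unfolding d_def durfee_rows_def by (intro Max_in finite_durfee) blast
  then have sub: "{..<d} \<times> {..<d + e} \<subseteq> young_diagram p" by simp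
  have row: "j < length p \<and> d + e \<le> p ! j" if "j < d" for j
  proof -
    have "(j, d + e - 1) \<in> young_diagram p" using sub that by auto
    then show ?thesis by (auto simp: young_diagram_def)
  qed
  show len: "d \<le> length p"
    using row[of "d - 1"] by (cases d) auto
  show "\<forall>y\<in>set (take d p). d + e \<le> y"
    using row by (auto simp: in_set_conv_nth)
  show "\<forall>y\<in>set (drop d p). y \<le> d + e"
  proof (rule ballI, rule ccontr)
    fix y assume "y \<in> set (drop d p)" and y: "\<not> y \<le> d + e"
    then obtain j where "j < length (drop d p)" "y = drop d p ! j"
      by (metis in_set_conv_nth)
    then have j: "d + j < length p" "y = p ! (d + j)"
      using len by auto
    have "Suc d + e \<le> p ! k" if "k < Suc d" for k
    proof -
      have "p ! (d + j) \<le> p ! k"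
        using p j that by (cases "k = d + j") (auto simp: sorted_wrt_iff_nth_less)
      then show ?thesis using y j by simp
    qed
    then have "{..<Suc d} \<times> {..<Suc d + e} \<subseteq> young_diagram p"
      using j by (fastforce simp: young_diagram_def)
    then have "Suc d \<in> {d. {..<d} \<times> {..<d + e} \<subseteq> young_diagram p}" by simp
    then have "Suc d \<le> d"
      unfolding d_def durfee_rows_def by (rule Max_ge[OF finite_durfee])
    then show False by simp
  qed
qed

text \<open>
  Removes one rectangle after the other from the top; the list has the excess of columns over rows of each.
\<close>

fun dissect :: "nat list \<Rightarrow> nat list \<Rightarrow> nat list" where
  "dissect [] p = p"
| "dissect (e # w) p = dissect w (below_durfee e p)"

definition dissectable :: "nat list \<Rightarrow> nat \<Rightarrow> nat list set" where
  "dissectable w N = {p. sorted_wrt (\<ge>) p \<and> (\<forall>y\<in>set p. 0 < y \<and> y \<le> N) \<and> dissect w p = []}"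

lemma dissect_append: "dissect (v @ w) p = dissect w (dissect v p)"
  by (induction v arbitrary: p) simp_all

lemma dissect_replicate: "dissect (replicate n e) p = (below_durfee e ^^ n) p"
  by (induction n arbitrary: p) (simp_all add: funpow_Suc_right del: funpow.simps)

text \<open>
  The partitions are cut into the topmost rectangle with \<open>d\<close> rows, the box partition to its right and the
  rest below it. The bound \<open>N + e\<close> on the parts leaves \<open>N - d\<close> columns to the right of the \<open>d + e\<close> columns
  of the rectangle, which is why the excess \<open>e\<close> only moves the argument.
\<close>

lemma dissectable_Cons:
  "bij_betw (\<lambda>(d, u, v). map (\<lambda>y. y + (d + e)) u @ v)
     (SIGMA d:{..N}. box d (N - d) \<times> dissectable w (d + e)) (dissectable (e # w) (N + e))"
proof (rule bij_betw_byWitness[where f' = "\<lambda>p. let d = durfee_rows e p in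
    (d, map (\<lambda>y. y - (d + e)) (take d p), drop d p)"])
  let ?S = "SIGMA d:{..N}. box d (N - d) \<times> dissectable w (d + e)"
  let ?f = "\<lambda>(d, u, v). map (\<lambda>y. y + (d + e)) u @ v"
  let ?g = "\<lambda>p. let d = durfee_rows e p in (d, map (\<lambda>y. y - (d + e)) (take d p), drop d p)"
  have rows: "durfee_rows e (map (\<lambda>y. y + (d + e)) u @ v) = d"
    if "u \<in> box d (N - d)" "v \<in> dissectable w (d + e)" for d u v
  proof -
    have "length u = d" using that by (simp add: box_def)
    then show ?thesis
      using that durfee_rows_append[of "map (\<lambda>y. y + (d + e)) u" e v] by (simp add: dissectable_def)
  qed
  show "\<forall>t\<in>?S. ?g (?f t) = t"
  proof
    fix t assume "t \<in> ?S"
    then obtain d u v where t: "t = (d, u, v)" "u \<in> box d (N - d)" "v \<in> dissectable w (d + e)"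
      by auto
    have "length u = d" using t by (simp add: box_def)
    then show "?g (?f t) = t"
      using rows[OF t(2,3)] by (simp add: t(1) Let_def o_def)
  qed
  show "?f ` ?S \<subseteq> dissectable (e # w) (N + e)"
  proof (rule image_subsetI)
    fix t assume "t \<in> ?S"
    then obtain d u v where t: "t = (d, u, v)" "d \<le> N" "u \<in> box d (N - d)" "v \<in> dissectable w (d + e)"
      by auto
    have len: "length u = d" using t by (simp add: box_def)
    have "below_durfee e (map (\<lambda>y. y + (d + e)) u @ v) = v"
      using rows[OF t(3,4)] len by (simp add: below_durfee_def)
    moreover have "sorted_wrt (\<ge>) (map (\<lambda>y. y + (d + e)) u @ v)"
      using t by (force simp: sorted_wrt_append sorted_wrt_map box_def dissectable_def)
    moreover have "0 < y \<and> y \<le> N + e" if "y \<in> set (map (\<lambda>y. y + (d + e)) u @ v)" for y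
    proof (cases "y \<in> set v")
      case False
      then have "y \<in> (\<lambda>y. y + (d + e)) ` set u" using that by simp
      then obtain z where "z \<in> set u" "y = z + (d + e)" by blast
      moreover have "d > 0" using \<open>z \<in> set u\<close> len by (cases u) auto
      ultimately show ?thesis using t by (auto simp: box_def)
    next
      case True
      then show ?thesis using t by (auto simp: dissectable_def)
    qed
    ultimately show "?f t \<in> dissectable (e # w) (N + e)"
      using t(4) by (simp add: t(1) dissectable_def)
  qed
  have inverse: "?g p \<in> ?S \<and> ?f (?g p) = p" if p: "p \<in> dissectable (e # w) (N + e)" for p
  proof -
    define d where "d = durfee_rows e p"
    define u v where "u = take d p" and "v = drop d p"
    have srt: "sorted_wrt (\<ge>) p" and remainder: "dissect w v = []"
      and pos: "\<And>y. y \<in> set p \<Longrightarrow> 0 < y \<and> y \<le> N + e"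
      using p by (auto simp: dissectable_def below_durfee_def d_def v_def)
    have d: "d \<le> length p" "\<And>y. y \<in> set u \<Longrightarrow> d + e \<le> y" "\<And>y. y \<in> set v \<Longrightarrow> y \<le> d + e"
      using durfee_rows_split[OF srt, of e] by (auto simp: d_def u_def v_def)
    have uv: "p = u @ v" by (simp add: u_def v_def)
    have len: "length u = d" using d(1) by (simp add: u_def)
    have ub: "y \<le> N + e" if "y \<in> set u" for y using pos[of y] that by (simp add: uv)
    have "d \<le> N"
    proof (cases u)
      case Nil
      then show ?thesis using len by simp
    next
      case (Cons y u')
      then show ?thesis using d(2)[of y] ub[of y] by simp
    qed
    moreover have "sorted_wrt (\<ge>) (map (\<lambda>y. y - (d + e)) u)"
    proof -
      have "sorted_wrt (\<ge>) u" using srt by (simp add: uv sorted_wrt_append)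
      then show ?thesis unfolding sorted_wrt_map by (rule sorted_wrt_mono_rel[rotated]) simp
    qed
    then have "map (\<lambda>y. y - (d + e)) u \<in> box d (N - d)"
      using len ub \<open>d \<le> N\<close> by (fastforce simp: box_def)
    moreover have "v \<in> dissectable w (d + e)"
      using srt remainder pos d(3) by (simp add: dissectable_def uv sorted_wrt_append)
    moreover have "map (\<lambda>y. y + (d + e)) (map (\<lambda>y. y - (d + e)) u) = u"
      using d(2) by (auto simp: intro: map_idI)
    ultimately show ?thesis
      unfolding Let_def d_def[symmetric] u_def[symmetric] v_def[symmetric] by (simp add: uv)
  qed
  show "\<forall>p\<in>dissectable (e # w) (N + e). ?f (?g p) = p" using inverse by blast
  show "?g ` dissectable (e # w) (N + e) \<subseteq> ?S" using inverse by blast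
qed

lemma finite_dissectable: "finite (dissectable w N)"
proof (induction w arbitrary: N)
  case Nil
  have "dissectable [] N \<subseteq> {[]}" by (auto simp: dissectable_def)
  then show ?case by (rule finite_subset) simp
next
  case (Cons e w)
  have "finite (SIGMA d:{..N}. box d (N - d) \<times> dissectable w (d + e))"
    using Cons by (intro finite_SigmaI finite_cartesian_product) auto
  then have "finite (dissectable (e # w) (N + e))"
    using bij_betw_finite[OF dissectable_Cons] by blast
  then show ?case by (rule finite_subset[rotated]) (auto simp: dissectable_def)
qed

definition partition_gf :: "'a::comm_ring_1 \<Rightarrow> 'a \<Rightarrow> nat list set \<Rightarrow> 'a" where
  "partition_gf q x A = (\<Sum>p\<in>A. x ^ length p * q ^ sum_list p)"

lemma partition_gf_Nil: "partition_gf q x (dissectable [] N) = 1"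
proof -
  have "dissectable [] N = {[]}" by (auto simp: dissectable_def)
  then show ?thesis by (simp add: partition_gf_def)
qed

lemma partition_gf_Cons:
  "partition_gf q x (dissectable (e # w) (N + e)) =
     durfee_op q (x * q ^ e) (\<lambda>d. partition_gf q x (dissectable w (d + e))) N"
proof -
  let ?f = "\<lambda>(d, u, v). map (\<lambda>y. y + (d + e)) u @ v"
  let ?w = "\<lambda>p. x ^ length p * q ^ sum_list p"
  have weight: "?w (?f (d, u, v)) = (x * q ^ e) ^ d * q ^ (d * d) * (q ^ sum_list u * ?w v)"
    if "u \<in> box d (N - d)" for d u v
  proof -
    have len: "length u = d" using that by (simp add: box_def)
    have "sum_list (map (\<lambda>y. y + (d + e)) u) = sum_list u + d * (d + e)"
      using len by (simp add: sum_list_addf sum_list_triv distrib_left)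
    then show ?thesis
      by (simp add: len power_add power_mult power_mult_distrib distrib_left mult_ac flip: power_mult[of q e d])
  qed
  have "partition_gf q x (dissectable (e # w) (N + e)) =
      (\<Sum>t\<in>(SIGMA d:{..N}. box d (N - d) \<times> dissectable w (d + e)). ?w (?f t))"
    unfolding partition_gf_def by (rule sum.reindex_bij_betw[OF dissectable_Cons, symmetric])
  also have "\<dots> = (\<Sum>d\<le>N. \<Sum>t\<in>box d (N - d) \<times> dissectable w (d + e). ?w (?f (d, t)))"
    by (subst sum.Sigma) (auto simp: finite_dissectable split_def)
  also have "\<dots> = (\<Sum>d\<le>N. \<Sum>u\<in>box d (N - d). \<Sum>v\<in>dissectable w (d + e). ?w (?f (d, u, v)))"
    by (subst sum.cartesian_product) (simp add: split_def)
  also have "\<dots> = (\<Sum>d\<le>N. (x * q ^ e) ^ d * q ^ (d * d) *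
      (\<Sum>u\<in>box d (N - d). \<Sum>v\<in>dissectable w (d + e). q ^ sum_list u * ?w v))"
    unfolding sum_distrib_left by (intro sum.cong refl weight)
  also have "\<dots> = durfee_op q (x * q ^ e) (\<lambda>d. partition_gf q x (dissectable w (d + e))) N"
    by (simp only: durfee_op_def gauss_def partition_gf_def mult.assoc sum_product)
  finally show ?thesis .
qed

lemma partition_gf_squares:
  "partition_gf q x (dissectable (replicate b 0) N) = (durfee_op q x ^^ b) (\<lambda>_. 1) N"
proof (induction b arbitrary: N)
  case 0
  then show ?case by (simp add: partition_gf_Nil)
next
  case (Suc b)
  then show ?case using partition_gf_Cons[of q x 0 "replicate b 0" N] by simp
qed

lemma partition_gf_rectangles_squares:
  "partition_gf q x (dissectable (replicate (r - i) 1 @ replicate (i - 1) 0) (Suc N)) =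
     rect_square_gf q r i x N"
proof -
  have "partition_gf q x (dissectable (replicate a 1 @ replicate b 0) (Suc N)) =
      (durfee_op q (x * q) ^^ a) (\<lambda>N. (durfee_op q x ^^ b) (\<lambda>_. 1) (Suc N)) N" for a b
  proof (induction a arbitrary: N)
    case 0
    then show ?case by (simp add: partition_gf_squares)
  next
    case (Suc a)
    then show ?case
      using partition_gf_Cons[of q x 1 "replicate a 1 @ replicate b 0" N] by simp
  qed
  then show ?thesis by (simp add: rect_square_gf_def)
qed

section \<open>Recurrence for partitions with a Durfee dissection\<close>

lemma coeff_sum_monom:
  "finite A \<Longrightarrow> coeff (\<Sum>p\<in>A. monom (1 :: rat) (f p)) m = of_nat (card {p \<in> A. f p = m})"
  by (simp add: coeff_sum flip: sum.inter_filter)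

text \<open>
  Two polynomials over the rationals with the same values have the same coefficients.
\<close>

lemma card_eq_if_power_sums_eq:
  fixes f :: "'b \<Rightarrow> nat" and g :: "'c \<Rightarrow> nat" and h :: "'d \<Rightarrow> nat"
  assumes fin: "finite A" "finite B" "finite C"
    and eq: "\<And>c::rat. (\<Sum>p\<in>A. c ^ f p) = (\<Sum>p\<in>B. c ^ g p) + (\<Sum>p\<in>C. c ^ h p)"
  shows "card {p \<in> A. f p = m} = card {p \<in> B. g p = m} + card {p \<in> C. h p = m}"
proof -
  define P Q R where "P = (\<Sum>p\<in>A. monom (1 :: rat) (f p))"
    and "Q = (\<Sum>p\<in>B. monom (1 :: rat) (g p))" and "R = (\<Sum>p\<in>C. monom (1 :: rat) (h p))"
  have "poly P = poly (Q + R)"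
    using eq by (simp add: fun_eq_iff P_def Q_def R_def poly_sum poly_monom)
  then have "P = Q + R" by (simp only: poly_eq_poly_eq_iff)
  then have "coeff P m = coeff Q m + coeff R m" by simp
  then have "(of_nat (card {p \<in> A. f p = m}) :: rat) =
      of_nat (card {p \<in> B. g p = m} + card {p \<in> C. h p = m})"
    by (simp only: P_def Q_def R_def coeff_sum_monom fin of_nat_add)
  then show ?thesis by (simp only: of_nat_eq_iff)
qed

lemma nth_eq_0_if_X_power_dvd:
  fixes f :: "'a::comm_ring_1 fps"
  assumes "fps_X ^ M dvd f" "n < M"
  shows "f $ n = 0"
proof -
  obtain g where "f = fps_X ^ M * g" using assms(1) by blast
  then show ?thesis using assms(2) by (simp add: fps_X_power_mult_nth)
qed

lemma partition_gf_nth: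
  fixes c :: "'a::comm_ring_1"
  assumes "finite A"
  shows "partition_gf fps_X (fps_const c) A $ n = (\<Sum>p\<in>{p \<in> A. sum_list p = n}. c ^ length p)"
proof -
  have "partition_gf fps_X (fps_const c) A $ n = (\<Sum>p\<in>A. if sum_list p = n then c ^ length p else 0)"
    unfolding partition_gf_def fps_sum_nth
    by (intro sum.cong refl) (auto simp: fps_const_power fps_X_power_nth)
  then show ?thesis using assms by (simp add: sum.inter_filter)
qed

lemma partition_gf_shifted_nth:
  fixes c :: "'a::comm_ring_1"
  assumes "finite A"
  shows "((fps_const c * fps_X) ^ k * partition_gf fps_X (fps_const c * fps_X) A) $ n =
    (\<Sum>p\<in>{p \<in> A. k + length p + sum_list p = n}. c ^ (k + length p))"
proof -
  have "((fps_const c * fps_X) ^ k * partition_gf fps_X (fps_const c * fps_X) A) =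
      (\<Sum>p\<in>A. fps_const (c ^ (k + length p)) * fps_X ^ (k + length p + sum_list p))"
    unfolding partition_gf_def sum_distrib_left
    by (intro sum.cong refl) (simp add: power_mult_distrib power_add mult_ac flip: fps_const_power fps_const_mult)
  then have "((fps_const c * fps_X) ^ k * partition_gf fps_X (fps_const c * fps_X) A) $ n =
      (\<Sum>p\<in>A. if k + length p + sum_list p = n then c ^ (k + length p) else 0)"
    by (simp only: fps_sum_nth) (intro sum.cong refl, simp add: fps_X_power_nth)
  then show ?thesis using assms by (simp add: sum.inter_filter)
qed


abbreviation rect_square_word :: "nat \<Rightarrow> nat \<Rightarrow> nat list" where
  "rect_square_word r i \<equiv> replicate (r - i) 1 @ replicate (i - 1) 0"

text \<open>
  The parts of a partition of \<open>n\<close> are at most \<open>n\<close>, so a bound on the parts that is at least \<open>n\<close> excludes none.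
\<close>

lemma \<C>_conv_dissectable:
  assumes "n \<le> Suc N"
  shows "\<C> r i (int n) = {p \<in> dissectable (rect_square_word r i) (Suc N). sum_list p = n}"
  using assms member_le_sum_list
  by (fastforce simp: \<C>_def dissectable_def partitions_def dissect_append dissect_replicate)

text \<open>
  The coefficient of \<open>q ^ n\<close> in the functional equation modulo \<open>q ^ (n + 1)\<close> is an equation between
  polynomials in \<open>x\<close>. In its last term a partition of \<open>n'\<close> with \<open>m'\<close> parts contributes to
  \<open>m = m' + (i - 1)\<close> and \<open>n = n' + m' + (i - 1) = n' + m\<close>.
\<close>

lemma c_parts_recurrence_nat:
  assumes i: "1 \<le> i" "i \<le> r"
  shows "c_parts r i (int m) (int n) = (if i = 1 then 0 else c_parts r (i - 1) (int m) (int n)) +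
    c_parts r (Suc (r - i)) (int m - int (i - 1)) (int n - int m)"
proof -
  \<comment> \<open>large enough for the functional equation modulo \<open>q ^ (n + 1)\<close>, and for the bound \<open>N + 1\<close> on the
    parts to exclude no partition of \<open>n\<close>\<close>
  define N where "N = 2 * Suc n"
  define D where "D i = dissectable (rect_square_word r i) (Suc N)" for i
  define k where "k = i - 1"
  define X where "X = {p \<in> D i. sum_list p = n}"
  define Y where "Y = (if i = 1 then {} else {p \<in> D (i - 1). sum_list p = n})"
  define Z where "Z = {p \<in> D (Suc (r - i)). k + length p + sum_list p = n}"
  have N: "2 * Suc n \<le> N" by (simp add: N_def)
  have fin: "finite (D i)" for i by (simp add: D_def finite_dissectable)
  have gf: "rect_square_gf q r i x N = partition_gf q x (D i)" for q x :: "rat fps" and i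
    unfolding D_def by (rule partition_gf_rectangles_squares[symmetric])
  have C: "\<C> r i (int l) = {p \<in> D i. sum_list p = l}" if "l \<le> n" for i l
    unfolding D_def using that by (intro \<C>_conv_dissectable) (simp add: N_def)
  have "card {p \<in> X. length p = m} = card {p \<in> Y. length p = m} + card {p \<in> Z. k + length p = m}"
  proof (rule card_eq_if_power_sums_eq)
    fix c :: rat
    let ?q = "fps_X :: rat fps" and ?x = "fps_const c"
    let ?Y = "if i = 1 then 0 else partition_gf ?q ?x (D (i - 1))"
    have "?q ^ Suc n dvd partition_gf ?q ?x (D i) - ?Y -
        (?x * ?q) ^ k * partition_gf ?q (?x * ?q) (D (Suc (r - i)))"
      using rect_square_gf_functional_eq[OF i N, of ?x] by (simp only: gf k_def)
    then have "(partition_gf ?q ?x (D i) - ?Y -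
        (?x * ?q) ^ k * partition_gf ?q (?x * ?q) (D (Suc (r - i)))) $ n = 0"
      by (rule nth_eq_0_if_X_power_dvd) simp
    moreover have "?Y $ n = (\<Sum>p\<in>Y. c ^ length p)"
      by (simp add: Y_def partition_gf_nth[OF fin])
    ultimately show "(\<Sum>p\<in>X. c ^ length p) = (\<Sum>p\<in>Y. c ^ length p) + (\<Sum>p\<in>Z. c ^ (k + length p))"
      unfolding X_def Z_def
      by (simp only: fps_sub_nth partition_gf_nth[OF fin] partition_gf_shifted_nth[OF fin])
  qed (use fin in \<open>auto simp: X_def Y_def Z_def\<close>)
  also have "{p \<in> X. length p = m} = {p \<in> \<C> r i (int n). int (length p) = int m}"
    by (auto simp: C X_def)
  also have "{p \<in> Y. length p = m} =
      (if i = 1 then {} else {p \<in> \<C> r (i - 1) (int n). int (length p) = int m})"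
    by (auto simp: C Y_def)
  also have "{p \<in> Z. k + length p = m} =
      {p \<in> \<C> r (Suc (r - i)) (int n - int m). int (length p) = int m - int k}"
  proof (cases "m \<le> n")
    case True
    then have "int n - int m = int (n - m)" by simp
    then have eq: "\<C> r (Suc (r - i)) (int n - int m) = {p \<in> D (Suc (r - i)). sum_list p = n - m}"
      by (simp only: C diff_le_self)
    have "k + length p + sum_list p = n \<and> k + length p = m \<longleftrightarrow>
        sum_list p = n - m \<and> int (length p) = int m - int k" for p :: "nat list"
      using True by linarith
    then show ?thesis unfolding eq Z_def by blast
  next
    case False
    have "\<not> (k + length p + sum_list p = n \<and> k + length p = m)" for p :: "nat list"
      using False by linarith
    then have "{p \<in> Z. k + length p = m} = {}" by (auto simp only: Z_def)
    moreover have "int (sum_list p) \<noteq> int n - int m" for p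
      using False by linarith
    then have "\<C> r (Suc (r - i)) (int n - int m) = {}" by (auto simp only: \<C>_def partitions_def)
    ultimately show ?thesis by (simp only: empty_iff simp_thms empty_def[symmetric])
  qed
  finally show ?thesis by (simp add: c_parts_def k_def)
qed

section \<open>Recurrence for partitions with a gap condition\<close>

lemma partition_split_ones:
  assumes "sorted_wrt (\<ge>) p" "\<forall>y\<in>set p. 0 < (y::nat)"
  obtains u where "p = u @ replicate (count_list p 1) 1" "\<forall>y\<in>set u. 2 \<le> y"
proof -
  have "\<exists>u c. p = u @ replicate c 1 \<and> (\<forall>y\<in>set u. 2 \<le> y)"
    using assms
  proof (induction p)
    case (Cons y p)
    then have "\<exists>u c. p = u @ replicate c 1 \<and> (\<forall>y\<in>set u. 2 \<le> y)" by simp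
    then obtain u c where u: "p = u @ replicate c 1" "\<forall>y\<in>set u. 2 \<le> y" by blast
    have le: "\<forall>z\<in>set p. z \<le> y" and pos: "0 < y" using Cons.prems by auto
    show ?case
    proof (cases "y = 1")
      case True
      have "u = []"
      proof (cases u)
        case (Cons z u')
        then have "z \<le> y" "2 \<le> z" using le u by auto
        then show ?thesis using True by simp
      qed
      then show ?thesis using True u by (intro exI[of _ "[]"] exI[of _ "Suc c"]) simp
    next
      case False
      then have "2 \<le> y" using pos by simp
      then show ?thesis using u by (intro exI[of _ "y # u"] exI[of _ c]) simp
    qed
  qed simp
  then obtain u c where u: "p = u @ replicate c 1" "\<forall>y\<in>set u. 2 \<le> y" by blast
  have "count_list (replicate c 1) (1 :: nat) = c" by (induction c) simp_all
  moreover have "count_list u 1 = 0" using u(2) by (auto simp: count_list_0_iff)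
  ultimately have "count_list p 1 = c" unfolding u(1) count_list_append by simp
  then have "p = u @ replicate (count_list p 1) 1" using u(1) by (rule ssubst)
  then show ?thesis using that u(2) by blast
qed

text \<open>
  This turns a bound on the number of ones into a condition on positions, the form of the gap condition.
\<close>

lemma count_ones_le_iff:
  assumes "sorted_wrt (\<ge>) p" "\<forall>y\<in>set p. 0 < (y::nat)"
  shows "count_list p 1 \<le> k \<longleftrightarrow> (\<forall>j. j + k < length p \<longrightarrow> 2 \<le> p ! j)"
proof -
  obtain u where u: "p = u @ replicate (count_list p 1) 1" "\<forall>y\<in>set u. 2 \<le> y"
    using partition_split_ones[OF assms] .
  define c where "c = count_list p 1"
  have p: "p = u @ replicate c 1" unfolding c_def by (rule u(1))
  have len: "length p = length u + c" by (simp add: p)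
  have big: "2 \<le> p ! j" if "j < length u" for j
    using that u(2) by (simp add: p nth_append)
  have one: "p ! length u = 1" if "0 < c"
    using that by (simp add: p nth_append)
  show ?thesis unfolding c_def[symmetric]
  proof
    assume "c \<le> k"
    then show "\<forall>j. j + k < length p \<longrightarrow> 2 \<le> p ! j" using big len by simp
  next
    assume *: "\<forall>j. j + k < length p \<longrightarrow> 2 \<le> p ! j"
    show "c \<le> k"
    proof (rule ccontr)
      assume "\<not> c \<le> k"
      then show False using *[rule_format, of "length u"] one len by simp
    qed
  qed
qed

definition gap_condition :: "nat \<Rightarrow> nat list \<Rightarrow> bool" where
  "gap_condition r p \<longleftrightarrow> (\<forall>j. j + r - 1 < length p \<longrightarrow> p ! j \<ge> p ! (j + r - 1) + 2)"

text \<open>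
  For positions \<open>j\<close> with \<open>j + r - 1\<close> among the appended ones, the gap condition says that the part at \<open>j\<close>
  was at least 2 before the shift. The last such \<open>j\<close> leaves room for \<open>r - i\<close> ones.
\<close>

lemma gap_condition_shift:
  assumes p: "sorted_wrt (\<ge>) p" "\<forall>y\<in>set p. 0 < y" and i: "1 \<le> i" "i \<le> r"
  shows "gap_condition r (map Suc p @ replicate (i - 1) 1) \<longleftrightarrow>
    gap_condition r p \<and> count_list p 1 \<le> r - i" (is "?L \<longleftrightarrow> ?R")
proof
  let ?p = "map Suc p @ replicate (i - 1) 1"
  assume ?L
  then have g: "?p ! j \<ge> ?p ! (j + r - 1) + 2" if "j + r - 1 < length ?p" for j
    using that by (simp add: gap_condition_def)
  have "p ! j \<ge> p ! (j + r - 1) + 2" if "j + r - 1 < length p" for j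
  proof -
    have "j < length p" using that i by simp
    then show ?thesis using g[of j] that by (simp add: nth_append)
  qed
  moreover have "2 \<le> p ! j" if "j + (r - i) < length p" for j
  proof (cases "j + r - 1 < length p")
    case True
    then show ?thesis using calculation[of j] by simp
  next
    case False
    have "j + r - 1 < length ?p" "j < length p" using that i by auto
    then have "?p ! (j + r - 1) + 2 \<le> ?p ! j" by (intro g)
    moreover have "?p ! (j + r - 1) = 1" "?p ! j = Suc (p ! j)"
      using False \<open>j + r - 1 < length ?p\<close> \<open>j < length p\<close> by (auto simp: nth_append)
    ultimately show ?thesis by simp
  qed
  ultimately show ?R
    unfolding gap_condition_def count_ones_le_iff[OF p] by blast
next
  let ?p = "map Suc p @ replicate (i - 1) 1"
  assume ?R
  then have R: "gap_condition r p" "\<forall>j. j + (r - i) < length p \<longrightarrow> 2 \<le> p ! j"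
    using count_ones_le_iff[OF p] by blast+
  show ?L unfolding gap_condition_def
  proof (intro allI impI)
    fix j assume j: "j + r - 1 < length ?p"
    then have jl: "j < length p" "j + (r - i) < length p" using i by auto
    show "?p ! j \<ge> ?p ! (j + r - 1) + 2"
    proof (cases "j + r - 1 < length p")
      case True
      then show ?thesis using R(1) jl by (simp add: gap_condition_def nth_append)
    next
      case False
      have "2 \<le> p ! j" using R(2) jl by blast
      moreover have "?p ! (j + r - 1) = 1" using False j by (simp add: nth_append)
      ultimately show ?thesis using jl by (simp add: nth_append)
    qed
  qed
qed

lemma \<B>_iff:
  "p \<in> \<B> r i n \<longleftrightarrow> p \<in> partitions n \<and> gap_condition r p \<and> count_list p 1 \<le> i - 1"
  by (auto simp: \<B>_def gap_condition_def)

lemma \<B>_ones_bij: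
  assumes i: "1 \<le> i" "i \<le> r"
  shows "bij_betw (\<lambda>p. map Suc p @ replicate (i - 1) 1)
    {p \<in> \<B> r (Suc (r - i)) (n - m). int (length p) = m - int (i - 1)}
    {p \<in> \<B> r i n. int (length p) = m \<and> count_list p 1 = i - 1}" (is "bij_betw ?f ?A ?B")
proof (rule bij_betw_imageI)
  show "inj_on ?f ?A" by (auto simp: inj_on_def)
  have count: "count_list (map Suc p) 1 = 0" if "\<forall>y\<in>set p. 0 < y" for p
    using that by (auto simp: count_list_0_iff)
  have ones: "count_list (replicate k 1) (1 :: nat) = k" for k
    by (induction k) simp_all
  show "?f ` ?A = ?B"
  proof (intro equalityI subsetI)
    fix p' assume "p' \<in> ?f ` ?A"
    then obtain p where p': "p' = ?f p" and p: "p \<in> ?A" by blast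
    have 1: "sorted_wrt (\<ge>) p" "\<forall>y\<in>set p. 0 < y" "int (sum_list p) = n - m"
      "int (length p) = m - int (i - 1)" "gap_condition r p" "count_list p 1 \<le> r - i"
      using p by (auto simp: \<B>_iff partitions_def)
    have "sum_list (map Suc p) = sum_list p + length p" by (induction p) auto
    then have "int (sum_list p') = n" using 1 by (simp add: p' sum_list_replicate)
    moreover have "sorted_wrt (\<ge>) p'"
    proof -
      have "sorted_wrt (\<ge>) (replicate (i - 1) (1 :: nat))"
        by (simp add: sorted_wrt_iff_nth_less)
      then show ?thesis using 1(1) by (simp add: p' sorted_wrt_append sorted_wrt_map)
    qed
    ultimately have "p' \<in> partitions n" by (auto simp: partitions_def p')
    moreover have "gap_condition r p'"
      using 1 gap_condition_shift[OF 1(1,2) i] by (simp add: p')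
    moreover have "count_list p' 1 = i - 1"
      unfolding p' count_list_append count[OF 1(2)] ones by simp
    ultimately show "p' \<in> ?B" using 1 by (simp add: \<B>_iff p')
  next
    fix p' assume p': "p' \<in> ?B"
    then have 1: "sorted_wrt (\<ge>) p'" "\<forall>y\<in>set p'. 0 < y" "int (sum_list p') = n"
      "int (length p') = m" "gap_condition r p'" "count_list p' 1 = i - 1"
      by (auto simp: \<B>_iff partitions_def)
    obtain u where u: "p' = u @ replicate (i - 1) 1" "\<forall>y\<in>set u. 2 \<le> y"
      using partition_split_ones[OF 1(1,2)] unfolding 1(6) .
    define p where "p = map (\<lambda>y. y - 1) u"
    have "map Suc p = u"
      unfolding p_def map_map using u(2) by (intro map_idI) auto
    then have f: "p' = ?f p" using u(1) by simp
    have pos: "\<forall>y\<in>set p. 0 < y" using u(2) by (auto simp: p_def)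
    have "sorted_wrt (\<ge>) (map Suc p)" using 1(1) f by (simp add: sorted_wrt_append)
    then have srt: "sorted_wrt (\<ge>) p" by (simp add: sorted_wrt_map)
    have "sum_list (map Suc p) = sum_list p + length p" by (induction p) auto
    then have "int (sum_list p) = n - m" "int (length p) = m - int (i - 1)"
      using 1(3,4) by (auto simp: f sum_list_replicate)
    moreover have "gap_condition r p \<and> count_list p 1 \<le> r - i"
      using gap_condition_shift[OF srt pos i] 1(5) f by simp
    ultimately have "p \<in> ?A" using srt pos by (simp add: \<B>_iff partitions_def)
    then show "p' \<in> ?f ` ?A" using f by blast
  qed
qed

lemma b_parts_recurrence:
  assumes i: "1 \<le> i" "i \<le> r"
  shows "b_parts r i m n = (if i = 1 then 0 else b_parts r (i - 1) m n) +
    b_parts r (Suc (r - i)) (m - int (i - 1)) (n - m)"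
proof -
  let ?S = "{p \<in> \<B> r i n. int (length p) = m}"
  let ?X = "if i = 1 then {} else {p \<in> \<B> r (i - 1) n. int (length p) = m}"
  let ?Y = "{p \<in> \<B> r i n. int (length p) = m \<and> count_list p 1 = i - 1}"
  have fin: "finite (\<B> r i n)" for i
    using finite_partitions by (rule finite_subset[rotated]) (auto simp: \<B>_def)
  have "?S = ?X \<union> ?Y" "?X \<inter> ?Y = {}"
    using i by (auto simp: \<B>_iff)
  then have "card ?S = card ?X + card ?Y"
    using fin by (simp add: card_Un_disjoint)
  also have "card ?Y = b_parts r (Suc (r - i)) (m - int (i - 1)) (n - m)"
    using bij_betw_same_card[OF \<B>_ones_bij[OF i]] by (simp add: b_parts_def)
  finally show ?thesis by (simp add: b_parts_def)
qed

section \<open>Equality of the two counts\<close>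

lemma parts_eq_0_if_negative:
  assumes "m < 0 \<or> n < 0"
  shows "b_parts r i m n = 0" "c_parts r i m n = 0"
proof -
  have "{p \<in> \<B> r i n. int (length p) = m} = {}" "{p \<in> \<C> r i n. int (length p) = m} = {}"
    using assms by (auto simp: \<B>_def \<C>_def partitions_def)
  then show "b_parts r i m n = 0" "c_parts r i m n = 0"
    by (simp_all only: b_parts_def c_parts_def card.empty)
qed

lemma b_parts_0_eq_c_parts_0:
  "b_parts r i 0 n = c_parts r i 0 n"
proof -
  have "below_durfee e [] = []" for e by (simp add: below_durfee_def)
  then have "(below_durfee e ^^ k) [] = []" for e k by (induction k) simp_all
  then have "{p \<in> \<B> r i n. int (length p) = 0} = {p \<in> \<C> r i n. int (length p) = 0}"
    by (auto simp: \<B>_def \<C>_def)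
  then show ?thesis by (simp only: b_parts_def c_parts_def)
qed

text \<open>
  The third term of the recurrence has the size \<open>n - m\<close>, smaller than \<open>n\<close> because \<open>m > 0\<close>; the second has
  the same size and a smaller \<open>i\<close>.
\<close>

lemma b_parts_eq_c_parts_nat:
  assumes "1 \<le> i" "i \<le> r"
  shows "b_parts r i (int m) (int n) = c_parts r i (int m) (int n)"
  using assms
proof (induction n arbitrary: m i rule: less_induct)
  case (less n)
  note smaller = less.IH
  show ?case
    using less.prems
  proof (induction i rule: nat_induct)
    case (Suc i)
    show ?case
    proof (cases "m = 0")
      case True
      then show ?thesis using b_parts_0_eq_c_parts_0 by simp
    next
      case False
      have third: "b_parts r (Suc (r - Suc i)) (int m - int i) (int n - int m) =
          c_parts r (Suc (r - Suc i)) (int m - int i) (int n - int m)"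
      proof (cases "i \<le> m \<and> m \<le> n")
        case True
        then have "int m - int i = int (m - i)" "int n - int m = int (n - m)" by auto
        moreover have "n - m < n" using True False by simp
        moreover have "1 \<le> Suc (r - Suc i)" "Suc (r - Suc i) \<le> r" using Suc.prems by auto
        ultimately show ?thesis by (simp only: smaller)
      next
        case False
        then have "int m - int i < 0 \<or> int n - int m < 0" by auto
        then show ?thesis by (simp only: parts_eq_0_if_negative)
      qed
      have second: "(if Suc i = 1 then 0 else b_parts r i (int m) (int n)) =
          (if Suc i = 1 then 0 else c_parts r i (int m) (int n))"
        using Suc by auto
      have "b_parts r (Suc i) (int m) (int n) = (if Suc i = 1 then 0 else b_parts r i (int m) (int n)) +
          b_parts r (Suc (r - Suc i)) (int m - int i) (int n - int m)"
        using b_parts_recurrence[OF Suc.prems] by (simp only: diff_Suc_1)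
      also have "\<dots> = c_parts r (Suc i) (int m) (int n)"
        using c_parts_recurrence_nat[OF Suc.prems] by (simp only: second third diff_Suc_1)
      finally show ?thesis .
    qed
  qed simp
qed

theorem theorem3p5:
  fixes r i :: nat and m n :: int
  assumes "2 \<le> r" and "1 \<le> i" and "i \<le> r"
  shows "b_parts r i m n = c_parts r i m n"
proof (cases "m < 0 \<or> n < 0")
  case True
  then show ?thesis by (simp add: parts_eq_0_if_negative)
next
  case False
  then show ?thesis
    using b_parts_eq_c_parts_nat[OF assms(2,3), of "nat m" "nat n"] by simp
qed

end
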